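(* Fix $\epsilon>0$ and integers $m\ge 2$ and $1\le k\le m$. Let $G\le S_m$ be $k$-transitive, i.e. $G$ acts transitively on the set $[m]_k$ of $k$-tuples of distinct elements of $[m]=\{1,\dots,m\}$. Then $$\left|B(H;G,[m]_k)\right|\ll H^{m+1+\epsilon}.$$
   Context: The height of $f=\sum_i a_ix^i\in\mathbb{Z}[x]$ is $H(f)=\max_i|a_i|$. For $n\in\mathbb{N}$ and real $H\ge 1$, $B_n(H)=\{f\in\mathbb{Z}[x]: f\text{ monic},\ \deg f=n,\ H(f)\le H\}$. For separable $f$, $\Omega_f=\{\alpha\in\mathbb{C}:f(\alpha)=0\}$ and $G_f=\mathrm{Gal}(\mathbb{Q}(\Omega_f)/\mathbb{Q})$, which acts naturally (faithfully) on $\Omega_f$. A permutation group $(G,\Omega)$ is a finite group $G$ with a faithful action on a finite set $\Omega$; an isomorphism $(G_1,\Omega_1)\cong(G_2,\Omega_2)$ is a pair $(\varphi,\varphi^* )$ of a group isomorphism $\varphi:G_1\to G_2$ and a bijection $\varphi^*:\Omega_1\to\Omega_2$ with $\varphi(\sigma)(\varphi^*(\omega))=\varphi^*(\sigma(\omega))$ for all $\sigma\in G_1,\omega\in\Omega_1$. Set $B(H;G,\Omega)=\{f\in B_{|\Omega|}(H): f\text{ separable},\ (G_f,\Omega_f)\cong(G,\Omega)\}$. Here $[m]_k=\{(v_1,\dots,v_k)\in[m]^k: v_i\ne v_j\text{ for }i\ne j\}$, and $S_m$ acts on $[m]_k$ coordinatewise. The notation $X\ll Y$ means that $X\le CY$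 for all $H\ge1$, with $C>0$ independent of $H$ (it may depend on all the other fixed data). *)

theory Defs
  imports
    Complex_Main
    "HOL-Algebra.Sym_Groups"
    "HOL-Algebra.Group_Action"
    "HOL-Algebra.Generated_Fields"
    "HOL-Algebra.Algebraic_Closure_Type"
    "HOL-Computational_Algebra.Polynomial"
begin

text \<open>Permutation groups: a finite group acting faithfully on a finite set. Following
  \<^locale>\<open>group_action\<close>, an action on \<open>\<Omega>\<close> is a homomorphism into \<^term>\<open>BijGroup \<Omega>\<close>, whose
  elements are extensional functions; this is why the actions below are wrapped in
  \<^const>\<open>restrict\<close>.\<close>

locale permutation_group = faithful_action G \<Omega> act
  for G (structure) and \<Omega> :: "'b set" and act +
  assumes finite_group: "finite (carrier G)"
    and finite_points: "finite \<Omega>"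

definition perm_group_iso ::
    "('g, 'x) monoid_scheme \<Rightarrow> 'a set \<Rightarrow> ('g \<Rightarrow> 'a \<Rightarrow> 'a) \<Rightarrow>
     ('h, 'y) monoid_scheme \<Rightarrow> 'b set \<Rightarrow> ('h \<Rightarrow> 'b \<Rightarrow> 'b) \<Rightarrow> bool" where
  "perm_group_iso G1 \<Omega>1 act1 G2 \<Omega>2 act2 \<longleftrightarrow>
     (\<exists>\<phi> \<psi>. \<phi> \<in> iso G1 G2 \<and> bij_betw \<psi> \<Omega>1 \<Omega>2 \<and>
        (\<forall>\<sigma> \<in> carrier G1. \<forall>\<omega> \<in> \<Omega>1. act2 (\<phi> \<sigma>) (\<psi> \<omega>) = \<psi> (act1 \<sigma> \<omega>)))"

definition poly_height :: "int poly \<Rightarrow> int" where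
  "poly_height f = Max ((\<lambda>i. \<bar>Polynomial.coeff f i\<bar>) ` {..Polynomial.degree f})"

definition monic_polys :: "nat \<Rightarrow> real \<Rightarrow> int poly set" where
  "monic_polys n H = {f. Polynomial.lead_coeff f = 1 \<and> Polynomial.degree f = n \<and>
                         real_of_int (poly_height f) \<le> H}"

abbreviation complex_poly :: "int poly \<Rightarrow> complex poly" where
  "complex_poly f \<equiv> map_poly of_int f"

definition complex_roots :: "int poly \<Rightarrow> complex set" where
  "complex_roots f = {\<alpha>. poly (complex_poly f) \<alpha> = 0}"

text \<open>Separable means having no repeated root in the algebraically closed field of complex
  numbers, i.e. every root has order one.\<close>

definition separable_poly :: "int poly \<Rightarrow> bool" where
  "separable_poly f \<longleftrightarrow> rsquarefree (complex_poly f)"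

abbreviation complex_ring :: "complex ring" where
  "complex_ring \<equiv> ring_of_type_algebra"

definition rat_adjoin :: "complex set \<Rightarrow> complex set" where
  "rat_adjoin S = generate_field complex_ring (\<rat> \<union> S)"

definition galois_group :: "complex set \<Rightarrow> complex set \<Rightarrow> (complex \<Rightarrow> complex) monoid" where
  "galois_group L K = (BijGroup L)
     \<lparr>carrier := {\<sigma> \<in> Bij L. \<sigma> \<in> ring_iso (complex_ring\<lparr>carrier := L\<rparr>) (complex_ring\<lparr>carrier := L\<rparr>) \<and>
                             (\<forall>x \<in> K. \<sigma> x = x)}\<rparr>"

definition poly_galois_group :: "int poly \<Rightarrow> (complex \<Rightarrow> complex) monoid" where
  "poly_galois_group f = galois_group (rat_adjoin (complex_roots f)) \<rat>"

definition root_action :: "int poly \<Rightarrow> (complex \<Rightarrow> complex) \<Rightarrow> complex \<Rightarrow> complex" where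
  "root_action f \<sigma> = restrict \<sigma> (complex_roots f)"

definition polys_with_galois_group ::
    "real \<Rightarrow> ('g, 'x) monoid_scheme \<Rightarrow> 'b set \<Rightarrow> ('g \<Rightarrow> 'b \<Rightarrow> 'b) \<Rightarrow> int poly set" where
  "polys_with_galois_group H G \<Omega> act =
     {f \<in> monic_polys (card \<Omega>) H. separable_poly f \<and>
        perm_group_iso (poly_galois_group f) (complex_roots f) (root_action f) G \<Omega> act}"

text \<open>The set \<open>[m]\<^sub>k\<close>, with \<open>k\<close>-tuples represented as lists, and the coordinatewise action of
  permutations of \<open>{1..m}\<close> on it.\<close>

definition distinct_tuples :: "nat \<Rightarrow> nat \<Rightarrow> nat list set" where
  "distinct_tuples m k = {v. length v = k \<and> set v \<subseteq> {1..m} \<and> distinct v}"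

definition tuple_action :: "nat \<Rightarrow> nat \<Rightarrow> (nat \<Rightarrow> nat) \<Rightarrow> nat list \<Rightarrow> nat list" where
  "tuple_action m k \<sigma> = restrict (map \<sigma>) (distinct_tuples m k)"

abbreviation perm_subgroup :: "nat \<Rightarrow> (nat \<Rightarrow> nat) set \<Rightarrow> (nat \<Rightarrow> nat) monoid" where
  "perm_subgroup m G \<equiv> (sym_group m)\<lparr>carrier := G\<rparr>"

definition k_transitive :: "nat \<Rightarrow> nat \<Rightarrow> (nat \<Rightarrow> nat) set \<Rightarrow> bool" where
  "k_transitive m k G \<longleftrightarrow>
     transitive_action (perm_subgroup m G) (distinct_tuples m k) (tuple_action m k)"

text \<open>The sets counted by \<^const>\<open>card\<close> are finite, and the two actions being compared are
  genuine permutation groups.\<close>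

lemma finite_monic_polys: "finite (monic_polys n H)"
proof -
  let ?S = "{p :: int list. set p \<subseteq> {-\<lceil>H\<rceil>..\<lceil>H\<rceil>} \<and> length p = Suc n}"
  have "f \<in> Poly ` ?S" if f: "f \<in> monic_polys n H" for f
  proof -
    have nz: "f \<noteq> 0" and deg: "Polynomial.degree f = n"
      and ht: "real_of_int (poly_height f) \<le> H"
      using f by (auto simp: monic_polys_def)
    have "\<bar>c\<bar> \<le> \<lceil>H\<rceil>" if "c \<in> set (coeffs f)" for c
    proof -
      have "\<bar>c\<bar> \<in> (\<lambda>i. \<bar>Polynomial.coeff f i\<bar>) ` {..Polynomial.degree f}"
        using that nz by (auto simp: coeffs_def)
      then have "\<bar>c\<bar> \<le> poly_height f"
        unfolding poly_height_def by (intro Max_ge) auto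
      then show ?thesis using ht by linarith
    qed
    then have "coeffs f \<in> ?S"
      using nz deg by (force simp: length_coeffs_degree abs_le_iff)
    then show ?thesis by (intro image_eqI[of _ _ "coeffs f"]) simp_all
  qed
  moreover have "finite ?S" by (rule finite_lists_length_eq) simp
  ultimately show ?thesis by (meson finite_imageI finite_subset subsetI)
qed

lemma tuple_permutation_group:
  assumes "subgroup G (sym_group m)" and "1 \<le> k" and "k \<le> m"
  shows "permutation_group (perm_subgroup m G) (distinct_tuples m k) (tuple_action m k)"
proof -
  let ?T = "distinct_tuples m k"
  have perm: "\<sigma> permutes {1..m}" if "\<sigma> \<in> G" for \<sigma>
    using subgroup.mem_carrier[OF assms(1) that] by (simp add: sym_group_carrier)
  have inT: "map \<sigma> v \<in> ?T" if "\<sigma> permutes {1..m}" "v \<in> ?T" for \<sigma> v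
    using that permutes_inj_on[OF that(1), of "set v"] permutes_image[OF that(1)]
    by (auto simp: distinct_tuples_def distinct_map simp del: permutes_image)
  have finT: "finite ?T"
    unfolding distinct_tuples_def
    by (rule finite_subset[OF _ finite_lists_length_eq[of "{1..m}" k]]) auto
  have bij: "tuple_action m k \<sigma> \<in> Bij ?T" if "\<sigma> \<in> G" for \<sigma>
  proof -
    have "inj_on (map \<sigma>) ?T"
      by (rule inj_onI) (metis permutes_inj[OF perm[OF that]] inj_mapI injD)
    then have "bij_betw (map \<sigma>) ?T ?T"
      using endo_inj_surj[OF finT] inT[OF perm[OF that]] by (auto simp: bij_betw_def)
    then show ?thesis by (simp add: Bij_def tuple_action_def)
  qed
  have grp: "group (perm_subgroup m G)"
    using sym_group_is_group assms(1) by (rule group.subgroup_imp_group)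
  have hom: "tuple_action m k \<in> hom (perm_subgroup m G) (BijGroup ?T)"
  proof (rule homI)
    fix \<sigma> assume "\<sigma> \<in> carrier (perm_subgroup m G)"
    then show "tuple_action m k \<sigma> \<in> carrier (BijGroup ?T)"
      using bij by (simp add: BijGroup_def)
  next
    fix \<sigma> \<tau> assume "\<sigma> \<in> carrier (perm_subgroup m G)" "\<tau> \<in> carrier (perm_subgroup m G)"
    then have st: "\<sigma> \<in> G" "\<tau> \<in> G" by auto
    have "tuple_action m k (\<sigma> \<circ> \<tau>) = compose ?T (tuple_action m k \<sigma>) (tuple_action m k \<tau>)"
      using inT[OF perm[OF st(2)]] by (auto simp: tuple_action_def compose_def fun_eq_iff)
    then show "tuple_action m k (\<sigma> \<otimes>\<^bsub>perm_subgroup m G\<^esub> \<tau>) =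
               tuple_action m k \<sigma> \<otimes>\<^bsub>BijGroup ?T\<^esub> tuple_action m k \<tau>"
      using bij st by (simp add: BijGroup_def sym_group_mult)
  qed
  have inj: "inj_on (tuple_action m k) G"
  proof (rule inj_onI)
    fix \<sigma> \<tau> assume st: "\<sigma> \<in> G" "\<tau> \<in> G" and eq: "tuple_action m k \<sigma> = tuple_action m k \<tau>"
    have "\<sigma> i = \<tau> i" for i
    proof (cases "i \<in> {1..m}")
      case True
      have "k - 1 \<le> card ({1..m} - {i})" using True assms by simp
      then obtain B where B: "B \<subseteq> {1..m} - {i}" "card B = k - 1" "finite B"
        by (meson obtain_subset_with_card_n)
      then obtain us where us: "set us = B" "distinct us"
        using finite_distinct_list by blast
      have "i # us \<in> ?T"
        using B us True assms(2) distinct_card[OF us(2)] by (auto simp: distinct_tuples_def)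
      then show ?thesis
        using fun_cong[OF eq, of "i # us"] by (simp add: tuple_action_def)
    next
      case False
      then show ?thesis using perm st by (metis permutes_not_in)
    qed
    then show "\<sigma> = \<tau>" by blast
  qed
  have "finite G"
    by (rule finite_subset[of _ "{p. p permutes {1..m}}"]) (use perm in \<open>auto simp: finite_permutations\<close>)
  then show ?thesis
    using grp hom inj finT group_BijGroup
    by (auto simp: permutation_group_def permutation_group_axioms_def faithful_action_def
        faithful_action_axioms_def group_action_def group_hom_def group_hom_axioms_def)
qed

lemma galois_permutation_group:
  assumes "separable_poly f"
  shows "permutation_group (poly_galois_group f) (complex_roots f) (root_action f)"
proof -
  define L where "L = rat_adjoin (complex_roots f)"
  let ?R = "complex_roots f"
  let ?G = "poly_galois_group f"
  let ?L = "complex_ring\<lparr>carrier := L\<rparr>"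
  note ring_simps = ring_of_type_algebra_def
  interpret C: Ring.field complex_ring by (rule field_from_type_algebra)
  have L_field: "subfield L complex_ring"
    unfolding L_def rat_adjoin_def by (rule C.generate_field_is_subfield) (simp add: ring_simps)
  have LR: "Ring.ring ?L"
    by (rule C.subring_is_ring[OF subfieldE(1)[OF L_field]])
  have RL: "?R \<subseteq> L" and QL: "\<rat> \<subseteq> L"
    by (auto simp: L_def rat_adjoin_def intro: generate_field.incl)
  have Lc: "1 \<in> L" "x \<in> L \<Longrightarrow> y \<in> L \<Longrightarrow> x + y \<in> L" "x \<in> L \<Longrightarrow> y \<in> L \<Longrightarrow> x * y \<in> L" for x y
    using subringE(3,6,7)[OF subfieldE(1)[OF L_field]] by (auto simp: ring_simps)
  have hom_iff: "\<sigma> \<in> ring_hom ?L ?L \<longleftrightarrow> (\<forall>x\<in>L. \<sigma> x \<in> L) \<and> \<sigma> 1 = 1 \<and>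
      (\<forall>x\<in>L. \<forall>y\<in>L. \<sigma> (x + y) = \<sigma> x + \<sigma> y \<and> \<sigma> (x * y) = \<sigma> x * \<sigma> y)" for \<sigma>
    by (auto simp: ring_hom_def ring_simps)
  have carr: "carrier ?G = {\<sigma> \<in> Bij L. \<sigma> \<in> ring_hom ?L ?L \<and> (\<forall>x \<in> \<rat>. \<sigma> x = x)}"
    by (auto simp: poly_galois_group_def galois_group_def L_def[symmetric] ring_iso_def Bij_def)
  have homD: "\<sigma> x \<in> L" "\<sigma> (x + y) = \<sigma> x + \<sigma> y" "\<sigma> (x * y) = \<sigma> x * \<sigma> y" "\<sigma> 1 = 1"
    if "\<sigma> \<in> carrier ?G" "x \<in> L" "y \<in> L" for \<sigma> x y
    using that by (auto simp: carr hom_iff)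
  have sub: "subgroup (carrier ?G) (BijGroup L)"
  proof (rule group.subgroupI[OF group_BijGroup])
    show "carrier ?G \<subseteq> carrier (BijGroup L)" by (auto simp: carr BijGroup_def)
    have "(\<lambda>x\<in>L. x) \<in> carrier ?G"
      using QL Lc by (auto simp: carr id_Bij hom_iff)
    then show "carrier ?G \<noteq> {}" by blast
  next
    fix \<sigma> assume s: "\<sigma> \<in> carrier ?G"
    then have b: "\<sigma> \<in> Bij L" and iso: "\<sigma> \<in> ring_iso ?L ?L" and fixed: "\<forall>x\<in>\<rat>. \<sigma> x = x"
      by (auto simp: carr ring_iso_def Bij_def)
    have inj: "inj_on \<sigma> L" using b by (auto simp: Bij_def bij_betw_def)
    have "inv_into L \<sigma> \<in> ring_iso ?L ?L"
      using ring_iso_set_sym[OF LR iso] by simp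
    then have "inv_into L \<sigma> \<in> ring_hom ?L ?L" by (simp add: ring_iso_def)
    then have "(\<lambda>x\<in>L. inv_into L \<sigma> x) \<in> ring_hom ?L ?L"
      using Lc by (simp add: hom_iff)
    moreover have "inv_into L \<sigma> x = x" if "x \<in> \<rat>" for x
      using that fixed QL inj by (metis inv_into_f_f subsetD)
    ultimately show "inv\<^bsub>BijGroup L\<^esub> \<sigma> \<in> carrier ?G"
      using b QL by (auto simp: carr inv_BijGroup restrict_inv_into_Bij)
  next
    fix \<sigma> \<tau> assume st: "\<sigma> \<in> carrier ?G" "\<tau> \<in> carrier ?G"
    have "compose L \<sigma> \<tau> \<in> ring_hom ?L ?L"
      using homD[OF st(1)] homD[OF st(2)] Lc by (simp add: hom_iff compose_def)
    then show "\<sigma> \<otimes>\<^bsub>BijGroup L\<^esub> \<tau> \<in> carrier ?G"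
      using st QL compose_Bij[of \<sigma> L \<tau>]
      by (auto simp: carr BijGroup_def) (auto simp: compose_def)
  qed
  have Geq: "?G = BijGroup L\<lparr>carrier := carrier ?G\<rparr>"
    by (simp add: poly_galois_group_def galois_group_def L_def)
  have grp: "group ?G"
    by (subst Geq) (rule group.subgroup_imp_group[OF group_BijGroup sub])
  have "complex_poly f \<noteq> 0"
    using assms by (simp add: separable_poly_def rsquarefree_def)
  then have finR: "finite ?R"
    unfolding complex_roots_def by (rule poly_roots_finite)
  have poly_hom: "\<sigma> (poly p x) = poly p (\<sigma> x) \<and> poly p x \<in> L"
    if s: "\<sigma> \<in> carrier ?G" and x: "x \<in> L" and p: "\<And>i. Polynomial.coeff p i \<in> \<rat>" for \<sigma> x p
    using p
  proof (induction p)
    case 0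
    then show ?case using QL s by (auto simp: carr)
  next
    case (pCons a p)
    have a: "a \<in> \<rat>" using pCons.prems[of 0] by simp
    have "Polynomial.coeff p i \<in> \<rat>" for i using pCons.prems[of "Suc i"] by simp
    then have IH: "\<sigma> (poly p x) = poly p (\<sigma> x)" "poly p x \<in> L" using pCons.IH by auto
    have m: "x * poly p x \<in> L"
      using subringE(6)[OF subfieldE(1)[OF L_field] x IH(2)] by (simp add: ring_simps)
    have "a + x * poly p x \<in> L"
      using subringE(7)[OF subfieldE(1)[OF L_field] _ m, of a] a QL by (auto simp: ring_simps)
    moreover have "\<sigma> a = a" using a s by (auto simp: carr)
    ultimately show ?case using homD[OF s] a QL m x IH by auto
  qed
  have root: "\<sigma> x \<in> ?R" if s: "\<sigma> \<in> carrier ?G" and x: "x \<in> ?R" for \<sigma> x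
  proof -
    have "poly (complex_poly f) (\<sigma> x) = \<sigma> (poly (complex_poly f) x)"
      using poly_hom[OF s, of x "complex_poly f"] RL x by (auto simp: coeff_map_poly)
    also have "\<dots> = 0" using x s by (auto simp: complex_roots_def carr)
    finally show ?thesis by (simp add: complex_roots_def)
  qed
  have bij: "root_action f \<sigma> \<in> Bij ?R" if s: "\<sigma> \<in> carrier ?G" for \<sigma>
  proof -
    have "inj_on \<sigma> ?R"
      using s RL by (auto simp: carr Bij_def bij_betw_def intro: inj_on_subset)
    then have "bij_betw \<sigma> ?R ?R"
      using endo_inj_surj[OF finR] root[OF s] by (auto simp: bij_betw_def)
    then show ?thesis by (simp add: Bij_def root_action_def)
  qed
  have hom: "root_action f \<in> hom ?G (BijGroup ?R)"
  proof (rule homI)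
    fix \<sigma> assume "\<sigma> \<in> carrier ?G"
    then show "root_action f \<sigma> \<in> carrier (BijGroup ?R)"
      using bij by (simp add: BijGroup_def)
  next
    fix \<sigma> \<tau> assume st: "\<sigma> \<in> carrier ?G" "\<tau> \<in> carrier ?G"
    have "root_action f (compose L \<sigma> \<tau>) = compose ?R (root_action f \<sigma>) (root_action f \<tau>)"
      using root[OF st(2)] RL by (auto simp: root_action_def compose_def fun_eq_iff)
    moreover have "\<sigma> \<otimes>\<^bsub>?G\<^esub> \<tau> = compose L \<sigma> \<tau>"
      using st by (subst Geq) (simp add: BijGroup_def carr)
    ultimately show "root_action f (\<sigma> \<otimes>\<^bsub>?G\<^esub> \<tau>) =
               root_action f \<sigma> \<otimes>\<^bsub>BijGroup ?R\<^esub> root_action f \<tau>"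
      using bij st by (simp add: BijGroup_def)
  qed
  have inj: "inj_on (root_action f) (carrier ?G)"
  proof (rule inj_onI)
    fix \<sigma> \<tau> assume st: "\<sigma> \<in> carrier ?G" "\<tau> \<in> carrier ?G"
      and eq: "root_action f \<sigma> = root_action f \<tau>"
    have neg: "- x \<in> L" if "x \<in> L" for x
    proof -
      have "-1 \<in> L" using QL by auto
      then show ?thesis
        using subringE(6)[OF subfieldE(1)[OF L_field] _ that, of "-1"] by (simp add: ring_simps)
    qed
    have "x \<in> L \<and> \<sigma> x = \<tau> x" if "x \<in> generate_field complex_ring (\<rat> \<union> ?R)" for x
      using that
    proof induction
      case one
      then show ?case using homD(4) st QL by (auto simp: ring_simps carr)
    next
      case (incl h)
      then show ?case
        using RL QL st fun_cong[OF eq, of h] by (auto simp: carr root_action_def)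
    next
      case (a_inv h)
      have e: "\<ominus>\<^bsub>complex_ring\<^esub> h = - 1 * h"
        by (rule C.minus_equality) (auto simp: ring_simps)
      have "-1 \<in> L" "\<sigma> (-1) = -1" "\<tau> (-1) = -1" using QL st by (auto simp: carr)
      then show ?case
        using a_inv neg[of h] homD(3)[OF st(1), of "-1" h] homD(3)[OF st(2), of "-1" h] unfolding e by simp
    next
      case (m_inv h)
      have h0: "h \<noteq> 0" using m_inv by (simp add: ring_simps)
      have e: "inv\<^bsub>complex_ring\<^esub> h = inverse h"
        by (rule C.comm_inv_char) (use h0 in \<open>auto simp: ring_simps\<close>)
      have iL: "inverse h \<in> L"
        using C.subfield_m_inv(1)[OF L_field, of h] m_inv h0 unfolding e by (simp add: ring_simps)
      have "\<sigma> h * \<sigma> (inverse h) = 1" "\<sigma> h * \<tau> (inverse h) = 1"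
        using homD(3,4)[OF st(1), of h "inverse h"] homD(3,4)[OF st(2), of h "inverse h"] iL m_inv h0
        by auto
      then have "\<sigma> (inverse h) = \<tau> (inverse h)"
        by (metis mult_cancel_left mult_zero_left zero_neq_one)
      then show ?case using iL unfolding e by simp
    next
      case (eng_add a b)
      then show ?case
        using homD(2)[OF st(1), of a b] homD(2)[OF st(2), of a b]
          subringE(7)[OF subfieldE(1)[OF L_field], of a b] by (simp add: ring_simps)
    next
      case (eng_mult a b)
      then show ?case
        using homD(3)[OF st(1), of a b] homD(3)[OF st(2), of a b]
          subringE(6)[OF subfieldE(1)[OF L_field], of a b] by (simp add: ring_simps)
    qed
    then have "\<sigma> x = \<tau> x" if "x \<in> L" for x using that by (simp add: L_def rat_adjoin_def)
    moreover have "\<sigma> \<in> extensional L" "\<tau> \<in> extensional L" using st by (auto simp: carr Bij_def)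
    ultimately show "\<sigma> = \<tau>" by (rule extensionalityI[rotated 2])
  qed
  have "finite (Bij ?R)"
    by (rule finite_subset[of _ "Pi\<^sub>E ?R (\<lambda>_. ?R)"])
       (use finite_PiE[OF finR finR] in \<open>auto simp: Bij_def PiE_def bij_betw_def\<close>)
  then have "finite (carrier ?G)"
    by (rule inj_on_finite[OF inj, rotated]) (use bij in auto)
  then show ?thesis
    using grp hom inj finR group_BijGroup
    by (auto simp: permutation_group_def permutation_group_axioms_def faithful_action_def
        faithful_action_axioms_def group_action_def group_hom_def group_hom_axioms_def)
qed

end

theory Submission
  imports
    Defs
    "HOL-Analysis.Summation_Tests"
    "Berlekamp_Zassenhaus.Mahler_Measure"
    "Jordan_Normal_Form.Char_Poly"
begin

text \<open>
  Let \<open>f\<close> be counted and let \<open>N = card [m]\<^sub>k\<close> be its degree. The isomorphism of permutation groups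
  labels the roots of \<open>f\<close> as \<open>\<alpha> v\<close> with \<open>v \<in> [m]\<^sub>k\<close>, and the Galois group acts on the labels through
  \<open>S\<^sub>m\<close>. The theorem follows by splitting the choice of \<open>f\<close> into two independent choices, one with
  \<open>O(H\<^sup>m)\<close> and one with \<open>O(H\<^sup>1\<^sup>+\<^sup>\<epsilon>)\<close> possibilities.

  First choice: a resolvent of degree \<open>m\<close>. For \<open>i \<in> {1..m}\<close> let \<open>\<gamma> i\<close> be the product of \<open>t - \<alpha> v\<close> over all
  labels \<open>v\<close> whose first entry is \<open>i\<close>; a suitable integer \<open>t\<close>, bounded in terms of \<open>m\<close> and \<open>k\<close>, makes
  these \<open>m\<close> algebraic integers distinct. They are permuted by the Galois group, so the monic polynomial
  with roots \<open>\<gamma> 1, \<dots>, \<gamma> m\<close> has rational integer values at integers. Because each root of \<open>f\<close> occurs in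
  only one \<open>\<gamma> i\<close>, these values are at most a constant times the Mahler measure of \<open>f\<close>, which is
  \<open>O(H)\<close> by Landau's inequality. The set \<open>\<Gamma>\<close> of the \<open>\<gamma> i\<close> is determined by \<open>m\<close> of the values, so there
  are \<open>O(H\<^sup>m)\<close> sets \<open>\<Gamma>\<close> (\<open>compatible_labelling_exists\<close>, \<open>card_sets_integral_values_le\<close>).

  Second choice: the polynomial \<open>f\<close> when \<open>\<Gamma>\<close> is known. The roots of \<open>f\<close> can now be indexed by the
  \<open>k\<close>-tuples of distinct elements of \<open>\<Gamma>\<close>, and every field embedding \<open>\<sigma>\<close> satisfies \<open>\<sigma> (a u) = a (\<sigma> u)\<close>.
  In other words \<open>a u\<close> is an algebraic integer in the field generated by the entries of \<open>u\<close>, and the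
  question is how many algebraic integers in a given number field of degree \<open>N\<close> have Mahler measure
  \<open>O(H)\<close>. For two polynomials with the same \<open>\<Gamma>\<close>, the product of the differences \<open>a u - a' u\<close> is an
  integer, and it is nonzero because, by transitivity, polynomials that share a root share all roots; so
  the vectors \<open>a\<close> are well separated (\<open>norm_of_root_difference_ge_1\<close>). Complex
  conjugation is one of the embeddings; it pairs up the coordinates, so that a vector \<open>a\<close> amounts to
  \<open>N\<close> real numbers. Rounding these injects the polynomials into the integer vectors \<open>n\<close> with
  \<open>\<Prod>max 1 \<bar>n u\<bar> = O(H)\<close>, and there are \<open>O(H\<^sup>1\<^sup>+\<^sup>\<epsilon>)\<close> of these (\<open>card_int_vectors_le\<close>,
  \<open>card_separated_conjugate_vectors_le\<close>). The constants depend on the degree only, not on the field.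

  Both steps need that an algebraic integer fixed by all embeddings is a rational integer. This is
  obtained from a primitive element (\<open>primitive_element\<close>, \<open>rational_if_fixed\<close>) and from the closure of
  algebraic integers under sums and products (\<open>algebraic_int_plus_times\<close>).
\<close>

section \<open>Algebraic integers form a ring\<close>

text \<open>The determinant trick: the numbers \<open>b i\<close> form an eigenvector of an integer matrix for the
  eigenvalue \<open>x\<close>, and the characteristic polynomial of that matrix is monic with integer
  coefficients.\<close>

lemma algebraic_int_if_stable_span:
  fixes x :: "'a::field_char_0" and b :: "'i \<Rightarrow> 'a"
  assumes "finite I" and "i \<in> I" and "b i \<noteq> 0"
    and stable: "\<And>i. i \<in> I \<Longrightarrow> \<exists>c::'i \<Rightarrow> int. x * b i = (\<Sum>j\<in>I. of_int (c j) * b j)"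
  shows "algebraic_int x"
proof -
  obtain h where h: "bij_betw h {0..<card I} I"
    using ex_bij_betw_nat_finite[OF assms(1)] by blast
  define n where "n = card I"
  note h = h[folded n_def]
  from stable obtain c :: "'i \<Rightarrow> 'i \<Rightarrow> int"
    where c: "\<And>i. i \<in> I \<Longrightarrow> x * b i = (\<Sum>j\<in>I. of_int (c i j) * b j)" by metis
  define A where "A = Matrix.mat n n (\<lambda>(r, s). c (h r) (h s))"
  define v where "v = Matrix.vec n (\<lambda>r. b (h r))"
  let ?A = "map_mat of_int A :: 'a mat"
  have A: "A \<in> carrier_mat n n" by (simp add: A_def)
  have "eigenvector ?A v x"
    unfolding eigenvector_def
  proof (intro conjI)
    show "v \<in> carrier_vec (dim_row ?A)" by (simp add: v_def A_def)
    obtain r where "r < n" "h r = i"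
      using h assms(2) by (auto simp: bij_betw_def image_iff)
    then have "v $ r \<noteq> 0" using assms(3) by (simp add: v_def)
    then show "v \<noteq> 0\<^sub>v (dim_row ?A)" using \<open>r < n\<close> by (auto simp: A_def)
    show "?A *\<^sub>v v = x \<cdot>\<^sub>v v"
    proof (rule eq_vecI)
      fix r assume "r < dim_vec (x \<cdot>\<^sub>v v)"
      then have r: "r < n" by (simp add: v_def)
      then have "h r \<in> I" using h by (auto simp: bij_betw_def)
      have "(?A *\<^sub>v v) $ r = (\<Sum>s = 0..<n. of_int (c (h r) (h s)) * b (h s))"
        using r by (simp add: A_def v_def scalar_prod_def)
      also have "\<dots> = (\<Sum>j\<in>I. of_int (c (h r) j) * b j)"
        by (rule sum.reindex_bij_betw[OF h])
      also have "\<dots> = (x \<cdot>\<^sub>v v) $ r" using c[OF \<open>h r \<in> I\<close>] r by (simp add: v_def)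
      finally show "(?A *\<^sub>v v) $ r = (x \<cdot>\<^sub>v v) $ r" .
    qed (simp add: A_def v_def)
  qed
  then have "eigenvalue ?A x" unfolding eigenvalue_def by blast
  then have "poly (char_poly ?A) x = 0"
    using eigenvalue_root_char_poly[of ?A n x] A by simp
  moreover have "char_poly ?A = map_poly of_int (char_poly A)"
    by (rule of_int_hom.char_poly_hom[OF A])
  moreover have "lead_coeff (char_poly A) = 1"
    using degree_monic_char_poly[OF A] by simp
  ultimately show ?thesis
    unfolding algebraic_int_altdef_ipoly by auto
qed

text \<open>A monic equation of degree \<open>n\<close> rewrites \<open>x\<^sup>n\<close>, the only multiple of a member of
  \<open>1, x, \<dots>, x\<^sup>n\<^sup>-\<^sup>1\<close> by \<open>x\<close> that is not again in this list.\<close>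

lemma algebraic_int_power_span:
  fixes x :: "'a::field_char_0"
  assumes "algebraic_int x"
  obtains n where "0 < n"
    and "\<And>i. i < n \<Longrightarrow> \<exists>d::nat \<Rightarrow> int. x * x ^ i = (\<Sum>j<n. of_int (d j) * x ^ j)"
proof -
  obtain p :: "int poly" where p: "poly (map_poly of_int p) x = 0" "lead_coeff p = 1"
    using assms unfolding algebraic_int_altdef_ipoly by auto
  define n where "n = Polynomial.degree p"
  have "n \<noteq> 0"
  proof
    assume "n = 0"
    then obtain c where "p = [:c:]" using degree_eq_zeroE n_def by metis
    then show False using p by auto
  qed
  have "0 = (\<Sum>j\<le>n. of_int (Polynomial.coeff p j) * x ^ j)"
    using p(1) by (simp add: poly_altdef n_def)
  also have "{..n} = insert n {..<n}" by auto
  also have "(\<Sum>j\<in>insert n {..<n}. of_int (Polynomial.coeff p j) * x ^ j)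
      = x ^ n + (\<Sum>j<n. of_int (Polynomial.coeff p j) * x ^ j)"
    using p(2) by (simp add: n_def)
  finally have top: "x ^ n = (\<Sum>j<n. of_int (- Polynomial.coeff p j) * x ^ j)"
    by (simp add: sum_negf eq_neg_iff_add_eq_0)
  have "\<exists>d::nat \<Rightarrow> int. x * x ^ i = (\<Sum>j<n. of_int (d j) * x ^ j)" if "i < n" for i
  proof (cases "Suc i = n")
    case True
    then show ?thesis using top by (metis power_Suc)
  next
    case False
    then have "Suc i < n" using that by simp
    then have "x * x ^ i = (\<Sum>j<n. of_int (if j = Suc i then 1 else 0) * x ^ j)"
      by (simp add: if_distrib[of of_int] if_distrib[of "\<lambda>c. c * _"] sum.delta cong: if_cong)
    then show ?thesis by (rule exI[of _ "\<lambda>j. if j = Suc i then 1 else 0"])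
  qed
  then show thesis using that \<open>n \<noteq> 0\<close> by blast
qed

definition int_span :: "'i set \<Rightarrow> ('i \<Rightarrow> 'a::ring_1) \<Rightarrow> 'a set" where
  "int_span I b = {z. \<exists>c::'i \<Rightarrow> int. z = (\<Sum>i\<in>I. of_int (c i) * b i)}"

lemma int_spanI: "z = (\<Sum>i\<in>I. of_int (c i) * b i) \<Longrightarrow> z \<in> int_span I b"
  by (auto simp: int_span_def)

lemma int_spanE:
  assumes "z \<in> int_span I b"
  obtains c :: "'i \<Rightarrow> int" where "z = (\<Sum>i\<in>I. of_int (c i) * b i)"
  using assms by (auto simp: int_span_def)

lemma int_span_add:
  assumes "y \<in> int_span I b" and "z \<in> int_span I b"
  shows "y + z \<in> int_span I b"
proof -
  obtain c d :: "_ \<Rightarrow> int" where "y = (\<Sum>i\<in>I. of_int (c i) * b i)" "z = (\<Sum>i\<in>I. of_int (d i) * b i)"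
    using assms by (auto elim!: int_spanE)
  then have "y + z = (\<Sum>i\<in>I. of_int (c i + d i) * b i)"
    by (simp add: distrib_right sum.distrib)
  then show ?thesis by (rule int_spanI)
qed

lemma int_span_scale:
  assumes "z \<in> int_span I b"
  shows "of_int a * z \<in> int_span I b"
proof -
  obtain c :: "_ \<Rightarrow> int" where "z = (\<Sum>i\<in>I. of_int (c i) * b i)"
    using assms by (auto elim!: int_spanE)
  then have "of_int a * z = (\<Sum>i\<in>I. of_int (a * c i) * b i)"
    by (simp add: sum_distrib_left mult.assoc)
  then show ?thesis by (rule int_spanI)
qed

lemma int_span_sum: "(\<And>l. l \<in> L \<Longrightarrow> g l \<in> int_span I b) \<Longrightarrow> sum g L \<in> int_span I b"
proof (induction L rule: infinite_finite_induct)
  case (insert l L)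
  then show ?case by (simp add: int_span_add)
qed (auto intro: int_spanI[where c = "\<lambda>_. 0"])

text \<open>The monomials \<open>x\<^sup>i y\<^sup>j\<close> of small degree span a finitely generated group that is stable under
  multiplication by \<open>x\<close> and by \<open>y\<close>, hence by \<open>x + y\<close> and \<open>x * y\<close>.\<close>

lemma algebraic_int_plus_times:
  fixes x y :: "'a::field_char_0"
  assumes "algebraic_int x" and "algebraic_int y"
  shows "algebraic_int (x + y)" and "algebraic_int (x * y)"
proof -
  obtain n where n: "0 < n"
    "\<And>i. i < n \<Longrightarrow> \<exists>d::nat \<Rightarrow> int. x * x ^ i = (\<Sum>j<n. of_int (d j) * x ^ j)"
    using algebraic_int_power_span[OF assms(1)] by metis
  obtain m where m: "0 < m"
    "\<And>i. i < m \<Longrightarrow> \<exists>d::nat \<Rightarrow> int. y * y ^ i = (\<Sum>j<m. of_int (d j) * y ^ j)"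
    using algebraic_int_power_span[OF assms(2)] by metis
  define I where "I = {..<n} \<times> {..<m}"
  define b where "b = (\<lambda>k. x ^ fst k * y ^ snd k)"
  define stable where "stable z \<longleftrightarrow> (\<forall>k\<in>I. z * b k \<in> int_span I b)" for z
  have basis: "x ^ i * y ^ j \<in> int_span I b" if "i < n" "j < m" for i j
  proof (rule int_spanI[where c = "\<lambda>l. if l = (i, j) then 1 else 0"])
    have "(\<Sum>l\<in>I. of_int (if l = (i, j) then 1 else 0) * b l)
        = (\<Sum>l\<in>I. if l = (i, j) then b l else 0)"
      by (rule sum.cong) auto
    then show "x ^ i * y ^ j = (\<Sum>l\<in>I. of_int (if l = (i, j) then 1 else 0) * b l)"
      using that by (simp add: I_def b_def sum.delta)
  qed
  have "stable x"
    unfolding stable_def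
  proof
    fix k assume "k \<in> I"
    then obtain i j where k: "k = (i, j)" "i < n" "j < m" by (auto simp: I_def)
    obtain d :: "nat \<Rightarrow> int" where d: "x * x ^ i = (\<Sum>i'<n. of_int (d i') * x ^ i')"
      using n(2)[OF k(2)] by blast
    have "x * b k = (x * x ^ i) * y ^ j" by (simp add: b_def k)
    also have "\<dots> = (\<Sum>i'<n. of_int (d i') * (x ^ i' * y ^ j))"
      by (simp only: d sum_distrib_right mult.assoc)
    also have "\<dots> \<in> int_span I b"
      using basis k(3) by (intro int_span_sum int_span_scale) simp
    finally show "x * b k \<in> int_span I b" .
  qed
  have "stable y"
    unfolding stable_def
  proof
    fix k assume "k \<in> I"
    then obtain i j where k: "k = (i, j)" "i < n" "j < m" by (auto simp: I_def)
    obtain d :: "nat \<Rightarrow> int" where d: "y * y ^ j = (\<Sum>j'<m. of_int (d j') * y ^ j')"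
      using m(2)[OF k(3)] by blast
    have "y * b k = x ^ i * (y * y ^ j)" by (simp add: b_def k)
    also have "\<dots> = (\<Sum>j'<m. of_int (d j') * (x ^ i * y ^ j'))"
      by (simp only: d sum_distrib_left mult.left_commute)
    also have "\<dots> \<in> int_span I b"
      using basis k(2) by (intro int_span_sum int_span_scale) simp
    finally show "y * b k \<in> int_span I b" .
  qed
  have alg: "algebraic_int z" if "stable z" for z
  proof (rule algebraic_int_if_stable_span)
    show "finite I" "(0, 0) \<in> I" "b (0, 0) \<noteq> 0"
      using n(1) m(1) by (auto simp: I_def b_def)
    show "\<exists>c::nat \<times> nat \<Rightarrow> int. z * b k = (\<Sum>l\<in>I. of_int (c l) * b l)" if "k \<in> I" for k
      using \<open>stable z\<close> that unfolding stable_def int_span_def by blast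
  qed
  have "stable (x + y)"
    using \<open>stable x\<close> \<open>stable y\<close> by (simp add: stable_def distrib_right int_span_add)
  then show "algebraic_int (x + y)" by (rule alg)
  have "stable (x * y)"
    unfolding stable_def
  proof
    fix k assume k: "k \<in> I"
    obtain d :: "nat \<times> nat \<Rightarrow> int" where d: "y * b k = (\<Sum>l\<in>I. of_int (d l) * b l)"
      using \<open>stable y\<close> k unfolding stable_def by (blast elim: int_spanE)
    have "(x * y) * b k = (\<Sum>l\<in>I. of_int (d l) * (x * b l))"
      by (simp only: mult.assoc d sum_distrib_left mult.left_commute)
    also have "\<dots> \<in> int_span I b"
      using \<open>stable x\<close> by (intro int_span_sum int_span_scale) (simp add: stable_def)
    finally show "(x * y) * b k \<in> int_span I b" .
  qed
  then show "algebraic_int (x * y)" by (rule alg)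
qed

lemma algebraic_int_diff:
  fixes x y :: "'a::field_char_0"
  assumes "algebraic_int x" and "algebraic_int y"
  shows "algebraic_int (x - y)"
  using algebraic_int_plus_times(1)[OF assms(1), of "- y"] assms(2) by simp

lemma algebraic_int_prod:
  fixes g :: "'i \<Rightarrow> 'a::field_char_0"
  assumes "\<And>i. i \<in> I \<Longrightarrow> algebraic_int (g i)"
  shows "algebraic_int (prod g I)"
  using assms
  by (induction I rule: infinite_finite_induct) (auto intro: algebraic_int_plus_times)

section \<open>Fixed elements of number fields\<close>

definition poly_over :: "'a set \<Rightarrow> 'a::zero poly \<Rightarrow> bool" where
  "poly_over E P \<longleftrightarrow> (\<forall>i. Polynomial.coeff P i \<in> E)"

definition complex_subfield :: "complex set \<Rightarrow> bool" where
  "complex_subfield E \<longleftrightarrow> \<rat> \<subseteq> E \<and> (\<forall>x\<in>E. \<forall>y\<in>E. x + y \<in> E \<and> x * y \<in> E) \<and> (\<forall>x\<in>E. inverse x \<in> E)"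

lemma complex_subfield_Rats: "complex_subfield \<rat>"
  by (auto simp: complex_subfield_def)

lemma complex_subfield_UNIV: "complex_subfield UNIV"
  by (auto simp: complex_subfield_def)

context
  fixes E assumes E: "complex_subfield E"
begin

lemma subfield_Rats: "x \<in> \<rat> \<Longrightarrow> x \<in> E"
  using E by (auto simp: complex_subfield_def)

lemma subfield_add: "x \<in> E \<Longrightarrow> y \<in> E \<Longrightarrow> x + y \<in> E"
  using E by (auto simp: complex_subfield_def)

lemma subfield_mult: "x \<in> E \<Longrightarrow> y \<in> E \<Longrightarrow> x * y \<in> E"
  using E by (auto simp: complex_subfield_def)

lemma subfield_inverse: "x \<in> E \<Longrightarrow> inverse x \<in> E"
  using E by (auto simp: complex_subfield_def)

lemma subfield_uminus: "x \<in> E \<Longrightarrow> - x \<in> E"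
  using subfield_mult[of "-1" x] subfield_Rats[of "-1"] by simp

lemma subfield_diff: "x \<in> E \<Longrightarrow> y \<in> E \<Longrightarrow> x - y \<in> E"
  using subfield_add[of x "- y"] subfield_uminus by simp

lemma subfield_divide: "x \<in> E \<Longrightarrow> y \<in> E \<Longrightarrow> x / y \<in> E"
  using subfield_mult[of x "inverse y"] subfield_inverse by (simp add: divide_inverse)

lemma subfield_0: "0 \<in> E" and subfield_1: "1 \<in> E"
  by (simp_all add: subfield_Rats)

lemma subfield_of_nat: "of_nat n \<in> E"
  by (simp add: subfield_Rats)

lemma subfield_prod: "(\<And>i. i \<in> I \<Longrightarrow> g i \<in> E) \<Longrightarrow> prod g I \<in> E"
  by (induction I rule: infinite_finite_induct) (auto intro: subfield_mult subfield_1)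

lemma poly_over_0: "poly_over E 0"
  by (simp add: poly_over_def subfield_0)

lemma poly_over_pCons: "poly_over E (pCons a P) \<longleftrightarrow> a \<in> E \<and> poly_over E P"
  unfolding poly_over_def by (metis coeff_pCons_0 coeff_pCons_Suc not0_implies_Suc)

lemma poly_over_1: "poly_over E 1"
  by (simp add: poly_over_def coeff_1 subfield_0 subfield_1)

lemma poly_over_add: "poly_over E P \<Longrightarrow> poly_over E Q \<Longrightarrow> poly_over E (P + Q)"
  by (simp add: poly_over_def subfield_add)

lemma poly_over_diff: "poly_over E P \<Longrightarrow> poly_over E Q \<Longrightarrow> poly_over E (P - Q)"
  by (simp add: poly_over_def subfield_diff)

lemma poly_over_smult: "a \<in> E \<Longrightarrow> poly_over E P \<Longrightarrow> poly_over E (Polynomial.smult a P)"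
  by (simp add: poly_over_def subfield_mult)

lemma poly_over_mult: "poly_over E P \<Longrightarrow> poly_over E Q \<Longrightarrow> poly_over E (P * Q)"
  by (induction P) (simp_all add: poly_over_0 poly_over_pCons poly_over_add poly_over_smult subfield_0)

lemma poly_over_pcompose: "poly_over E P \<Longrightarrow> poly_over E Q \<Longrightarrow> poly_over E (pcompose P Q)"
  by (induction P) (simp_all add: pcompose_pCons poly_over_0 poly_over_pCons poly_over_add poly_over_mult)

lemma poly_over_pderiv: "poly_over E P \<Longrightarrow> poly_over E (pderiv P)"
  by (simp add: poly_over_def coeff_pderiv subfield_mult subfield_Rats)

lemma poly_over_eval: "poly_over E P \<Longrightarrow> x \<in> E \<Longrightarrow> poly P x \<in> E"
  by (induction P) (auto simp: poly_over_pCons subfield_0 intro!: subfield_add subfield_mult)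

lemma poly_over_div_mod:
  assumes "poly_over E P" and "poly_over E D"
  shows "poly_over E (P div D) \<and> poly_over E (P mod D)"
proof (cases "D = 0")
  case True
  then show ?thesis using assms(1) by (simp add: poly_over_0)
next
  case False
  have lead: "c \<in> E \<Longrightarrow> c / Polynomial.coeff D (Polynomial.degree D) \<in> E" for c
    using assms(2) by (auto simp: poly_over_def intro: subfield_divide)
  from assms(1) show ?thesis
  proof (induction P)
    case 0
    then show ?case by (simp add: poly_over_0)
  next
    case (pCons a P)
    then have IH: "poly_over E (P div D)" "poly_over E (P mod D)" and a: "a \<in> E"
      by (simp_all add: poly_over_pCons)
    then have "poly_over E (pCons a (P mod D))" by (simp add: poly_over_pCons)
    then have b: "Polynomial.coeff (pCons a (P mod D)) (Polynomial.degree D) / Polynomial.coeff D (Polynomial.degree D) \<in> E"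
      using lead by (simp add: poly_over_def)
    show ?case
      using False IH a b assms(2)
      by (simp add: div_pCons_eq mod_pCons Let_def poly_over_pCons poly_over_diff poly_over_smult)
  qed
qed

text \<open>Euclid's algorithm uses the field operations on coefficients only, so it does not leave \<open>E\<close>.\<close>

lemma poly_over_bezout:
  assumes "poly_over E P" and "poly_over E R"
  shows "\<exists>D U V. poly_over E D \<and> poly_over E U \<and> poly_over E V \<and>
           D dvd P \<and> D dvd R \<and> D = U * P + V * R"
  using assms
proof (induction P R rule: eucl_induct)
  case (zero P)
  then show ?case
    using poly_over_0 poly_over_1 by (intro exI[of _ P] exI[of _ 1] exI[of _ 0] conjI) simp_all
next
  case (mod P R)
  then have dm: "poly_over E (P div R)" "poly_over E (P mod R)"
    using poly_over_div_mod by auto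
  then obtain D U V where D: "poly_over E D" "poly_over E U" "poly_over E V"
    "D dvd R" "D dvd P mod R" "D = U * R + V * (P mod R)"
    using mod by blast
  have "D = V * P + (U - V * (P div R)) * R"
    using D(6) by (simp add: minus_mult_div_eq_mod[symmetric] algebra_simps)
  moreover have "D dvd P" using D(4,5) by (metis dvd_mod_iff)
  moreover have "poly_over E (U - V * (P div R))"
    using D dm by (simp add: poly_over_diff poly_over_mult)
  ultimately show ?case using D by blast
qed

text \<open>The greatest common divisor of \<open>P\<close> and \<open>R\<close> can be taken over \<open>E\<close>. Its only root is \<open>a\<close>, and that
  root is simple because it is simple in \<open>R\<close>; so this divisor is \<open>c (X - a)\<close> and \<open>a\<close> is a quotient
  of its coefficients.\<close>

lemma common_root_in_subfield:
  assumes P: "poly_over E P" and R: "poly_over E R"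
    and roots: "poly P a = 0" "poly R a = 0"
    and only: "\<And>z. poly P z = 0 \<Longrightarrow> poly R z = 0 \<Longrightarrow> z = a"
    and simple: "poly (pderiv R) a \<noteq> 0"
  shows "a \<in> E"
proof -
  obtain D U V where D: "poly_over E D" "D dvd P" "D dvd R" "D = U * P + V * R"
    using poly_over_bezout[OF P R] by blast
  have "poly D a = 0" using roots by (simp add: D(4))
  then obtain D' where D': "D = [:- a, 1:] * D'"
    unfolding poly_eq_0_iff_dvd by (elim dvdE)
  have "R \<noteq> 0" using simple by auto
  then have "D' \<noteq> 0" using D(3) D' by auto
  have "poly D' z \<noteq> 0" for z
  proof
    assume "poly D' z = 0"
    then have "poly D z = 0" by (simp add: D')
    then have "poly P z = 0" "poly R z = 0" using D(2,3) by (auto elim!: dvdE)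
    then have "z = a" by (rule only)
    then have "[:- a, 1:] dvd D'" using \<open>poly D' z = 0\<close> by (simp add: poly_eq_0_iff_dvd)
    then obtain D'' where "D' = [:- a, 1:] * D''" by (elim dvdE)
    moreover obtain R' where "R = D * R'" using D(3) by (elim dvdE)
    ultimately have "R = [:- a, 1:] * ([:- a, 1:] * (D'' * R'))" by (simp only: D' mult_ac)
    then have "poly (pderiv R) a = 0" by (simp only: pderiv_mult poly_add poly_mult) simp
    then show False using simple by simp
  qed
  then have "constant (poly D')" using fundamental_theorem_of_algebra by blast
  then have "Polynomial.degree D' = 0" by (simp add: constant_degree)
  then obtain c where c: "D' = [:c:]" using degree_eq_zeroE by blast
  have "c \<noteq> 0" using \<open>D' \<noteq> 0\<close> c by simp
  have "D = [:- a * c, c:]" by (simp add: D' c)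
  then have "- a * c \<in> E" "c \<in> E" using D(1) by (simp_all add: poly_over_pCons)
  then have "- ((- a * c) / c) \<in> E" using subfield_divide subfield_uminus by blast
  then show ?thesis using \<open>c \<noteq> 0\<close> by simp
qed

end

text \<open>The leading coefficient is left free: only degrees and divisibility over the rationals matter.\<close>

definition is_min_poly :: "complex poly \<Rightarrow> complex \<Rightarrow> bool" where
  "is_min_poly p a \<longleftrightarrow> poly_over \<rat> p \<and> p \<noteq> 0 \<and> poly p a = 0 \<and>
     (\<forall>q. poly_over \<rat> q \<longrightarrow> poly q a = 0 \<longrightarrow> q \<noteq> 0 \<longrightarrow> Polynomial.degree p \<le> Polynomial.degree q)"

lemma is_min_poly_exists:
  assumes "algebraic a"
  obtains p where "is_min_poly p a"
proof -
  let ?Q = "\<lambda>q. poly_over \<rat> q \<and> q \<noteq> 0 \<and> poly q a = 0"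
  obtain q where "?Q q"
    using assms Ints_subset_Rats unfolding algebraic_def poly_over_def by blast
  then have "\<exists>p. ?Q p \<and> (\<forall>q. ?Q q \<longrightarrow> Polynomial.degree p \<le> Polynomial.degree q)"
    by (rule ex_has_least_nat)
  then show thesis using that by (auto simp: is_min_poly_def)
qed

lemma is_min_poly_degree_pos:
  assumes "is_min_poly p a"
  shows "0 < Polynomial.degree p"
proof (rule ccontr)
  assume "\<not> 0 < Polynomial.degree p"
  then obtain c where "p = [:c:]" using degree_eq_zeroE by blast
  then show False using assms by (auto simp: is_min_poly_def)
qed

lemma is_min_poly_dvd:
  assumes p: "is_min_poly p a" and q: "poly_over \<rat> q" "poly q a = 0"
  shows "p dvd q"
proof (rule ccontr)
  assume "\<not> p dvd q"
  then have "q mod p \<noteq> 0" by (simp add: dvd_eq_mod_eq_0)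
  moreover have "poly (q mod p) a = 0"
    using p q by (simp add: minus_div_mult_eq_mod[symmetric] is_min_poly_def)
  moreover have "poly_over \<rat> (q mod p)"
    using p q poly_over_div_mod[OF complex_subfield_Rats] by (simp add: is_min_poly_def)
  ultimately have "Polynomial.degree p \<le> Polynomial.degree (q mod p)"
    using p by (simp add: is_min_poly_def)
  moreover have "Polynomial.degree (q mod p) < Polynomial.degree p"
    using degree_mod_less[of p q] \<open>q mod p \<noteq> 0\<close> p by (auto simp: is_min_poly_def)
  ultimately show False by simp
qed

text \<open>Every root \<open>z\<close> of \<open>p\<close> is as good as \<open>a\<close>: if \<open>q\<close> is minimal for \<open>z\<close> and \<open>p = q c\<close>, then \<open>c\<close> is too
  short to vanish at \<open>a\<close>, so \<open>q\<close> does, which forces \<open>q\<close> to be as long as \<open>p\<close>.\<close>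

lemma is_min_poly_conjugate:
  assumes p: "is_min_poly p a" and z: "poly p z = 0"
  shows "is_min_poly p z"
proof -
  have "algebraic z"
    using p z unfolding algebraic_altdef is_min_poly_def poly_over_def by blast
  then obtain q where q: "is_min_poly q z" by (rule is_min_poly_exists)
  then have "q dvd p" using is_min_poly_dvd[OF q] p z by (auto simp: is_min_poly_def)
  then have pc: "p = q * (p div q)" by simp
  have "poly_over \<rat> (p div q)"
    using p q poly_over_div_mod[OF complex_subfield_Rats] by (simp add: is_min_poly_def)
  moreover have nz: "p div q \<noteq> 0" using p pc by (auto simp: is_min_poly_def)
  moreover have "Polynomial.degree (p div q) < Polynomial.degree p"
    using is_min_poly_degree_pos[OF q] nz q
    by (subst (2) pc) (auto simp: Polynomial.degree_mult_eq is_min_poly_def)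
  ultimately have "poly (p div q) a \<noteq> 0" using p unfolding is_min_poly_def by (metis not_le)
  moreover have "poly p a = poly q a * poly (p div q) a" by (subst pc) simp
  ultimately have "poly q a = 0" using p by (auto simp: is_min_poly_def)
  then have "Polynomial.degree p \<le> Polynomial.degree q" using p q by (auto simp: is_min_poly_def)
  then show ?thesis using p q z unfolding is_min_poly_def by (metis le_trans)
qed

lemma is_min_poly_pderiv:
  assumes p: "is_min_poly p a"
  shows "poly (pderiv p) a \<noteq> 0"
proof
  assume "poly (pderiv p) a = 0"
  moreover have "pderiv p \<noteq> 0" "Polynomial.degree (pderiv p) < Polynomial.degree p"
    using is_min_poly_degree_pos[OF p] by (auto simp: pderiv_eq_0_iff degree_pderiv)
  moreover have "poly_over \<rat> (pderiv p)"
    using p poly_over_pderiv[OF complex_subfield_Rats] by (simp add: is_min_poly_def)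
  ultimately show False using p unfolding is_min_poly_def by (metis not_le)
qed

lemma rsquarefree_card_roots:
  fixes p :: "complex poly"
  assumes "rsquarefree p"
  shows "card {z. poly p z = 0} = Polynomial.degree p"
proof -
  have "p \<noteq> 0" using assms by (simp add: rsquarefree_def)
  have "Polynomial.degree p = Polynomial.degree (Polynomial.smult (lead_coeff p) (\<Prod>z|poly p z = 0. [:- z, 1:]))"
    by (simp only: complex_poly_decompose_rsquarefree[OF assms])
  also have "\<dots> = (\<Sum>z|poly p z = 0. Polynomial.degree [:- z, 1:])"
    using \<open>p \<noteq> 0\<close> by (simp add: degree_prod_eq_sum_degree)
  finally show ?thesis by simp
qed

text \<open>For algebraic \<open>a\<close> this ring \<open>\<rat>[a]\<close> is the field \<open>\<rat>(a)\<close>; describing it by values of polynomials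
  makes its embeddings explicit.\<close>

definition rat_extension :: "complex \<Rightarrow> complex set" where
  "rat_extension a = {poly P a |P. poly_over \<rat> P}"

lemma rat_extensionI: "poly_over \<rat> P \<Longrightarrow> poly P a \<in> rat_extension a"
  by (auto simp: rat_extension_def)

lemma generator_in_rat_extension: "a \<in> rat_extension a"
  using rat_extensionI[of "[:0, 1:]" a]
  by (simp add: poly_over_pCons[OF complex_subfield_Rats] poly_over_0[OF complex_subfield_Rats]
      poly_over_1[OF complex_subfield_Rats])

text \<open>Inverses come from a Bezout identity between the minimal polynomial of \<open>a\<close> and a polynomial not
  vanishing at \<open>a\<close>: their common divisor is a constant, since otherwise the cofactor in the minimal
  polynomial would be a shorter polynomial vanishing at \<open>a\<close>.\<close>

lemma complex_subfield_rat_extension: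
  assumes "algebraic a"
  shows "complex_subfield (rat_extension a)"
proof -
  note Q = complex_subfield_Rats
  have "x \<in> rat_extension a" if "x \<in> \<rat>" for x
    using rat_extensionI[of "[:x:]" a] that by (simp add: poly_over_pCons[OF Q] poly_over_0[OF Q])
  moreover have "x + y \<in> rat_extension a" "x * y \<in> rat_extension a"
    if xy: "x \<in> rat_extension a" "y \<in> rat_extension a" for x y
  proof -
    obtain P R where "poly_over \<rat> P" "x = poly P a" "poly_over \<rat> R" "y = poly R a"
      using xy by (auto simp: rat_extension_def)
    then show "x + y \<in> rat_extension a" "x * y \<in> rat_extension a"
      using rat_extensionI[OF poly_over_add[OF Q], of P R a] rat_extensionI[OF poly_over_mult[OF Q], of P R a]
      by simp_all
  qed
  moreover have "inverse x \<in> rat_extension a" if x: "x \<in> rat_extension a" for x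
  proof (cases "x = 0")
    case True
    then show ?thesis using x by simp
  next
    case False
    obtain P where P: "poly_over \<rat> P" "x = poly P a" using x by (auto simp: rat_extension_def)
    obtain p where p: "is_min_poly p a" using is_min_poly_exists[OF assms] .
    obtain D U V where D: "poly_over \<rat> D" "poly_over \<rat> V" "D dvd p" "D dvd P" "D = U * p + V * P"
      using poly_over_bezout[OF Q _ P(1)] p unfolding is_min_poly_def by blast
    have Da: "poly D a \<noteq> 0" using D(4) P(2) False by (auto elim!: dvdE)
    have pc: "p = D * (p div D)" using D(3) by simp
    have "p div D \<noteq> 0" using p pc unfolding is_min_poly_def by (metis mult_zero_right)
    moreover have "poly_over \<rat> (p div D)"
      using p D(1) poly_over_div_mod[OF Q] by (simp add: is_min_poly_def)
    moreover have "poly (p div D) a = 0"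
    proof -
      have "poly p a = poly D a * poly (p div D) a" by (subst pc) simp
      then show ?thesis using Da p by (simp add: is_min_poly_def)
    qed
    ultimately have "Polynomial.degree p \<le> Polynomial.degree (p div D)"
      using p by (auto simp: is_min_poly_def)
    moreover have "Polynomial.degree p = Polynomial.degree D + Polynomial.degree (p div D)"
      using \<open>p div D \<noteq> 0\<close> Da by (subst pc, subst Polynomial.degree_mult_eq) auto
    ultimately have "Polynomial.degree D = 0" by simp
    then obtain d where d: "D = [:d:]" using degree_eq_zeroE by blast
    have "d \<in> \<rat>" using D(1) by (simp add: d poly_over_pCons[OF Q])
    have "poly V a * x = d" using p arg_cong[OF D(5), of "\<lambda>R. poly R a"] d P(2)
      by (simp add: is_min_poly_def)
    then have "inverse x = poly (Polynomial.smult (inverse d) V) a"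
      using False Da d by (simp add: field_simps)
    then show ?thesis
      using rat_extensionI[OF poly_over_smult[OF Q _ D(2)], of "inverse d" a] \<open>d \<in> \<rat>\<close> by simp
  qed
  ultimately show ?thesis by (auto simp: complex_subfield_def)
qed

lemma rat_extension_subset:
  assumes "complex_subfield E" and "a \<in> E"
  shows "rat_extension a \<subseteq> E"
proof
  fix x assume "x \<in> rat_extension a"
  then obtain P where "poly_over \<rat> P" "x = poly P a" by (auto simp: rat_extension_def)
  moreover have "poly_over E P"
    using \<open>poly_over \<rat> P\<close> subfield_Rats[OF assms(1)] by (auto simp: poly_over_def)
  ultimately show "x \<in> E" using poly_over_eval[OF assms(1)] assms(2) by simp
qed

text \<open>The generator is \<open>c = b + n a\<close>. With \<open>p\<close> and \<open>q\<close> minimal for \<open>a\<close> and \<open>b\<close>, the number \<open>a\<close> is a common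
  root of \<open>p\<close> and \<open>q (c - n X)\<close>, two polynomials over \<open>\<rat>(c)\<close>. A further common root pins down the
  value of \<open>n\<close>, so all but finitely many \<open>n\<close> make \<open>a\<close> the only one.\<close>

lemma primitive_element_of_two:
  assumes a: "algebraic_int a" and b: "algebraic_int b"
  obtains c where "algebraic_int c" and "a \<in> rat_extension c" and "b \<in> rat_extension c"
proof -
  obtain p where p: "is_min_poly p a" using is_min_poly_exists a by blast
  obtain q where q: "is_min_poly q b" using is_min_poly_exists b by blast
  \<comment> \<open>The values of \<open>n\<close> for which \<open>b + n a = w + n z\<close>. The pairs with \<open>z = a\<close> contribute only
    the number \<open>0\<close>, because division by zero gives \<open>0\<close>.\<close>
  let ?bad = "(\<lambda>(z, w). (w - b) / (a - z)) ` ({z. poly p z = 0} \<times> {w. poly q w = 0})"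
  have "finite ?bad"
    using p q by (intro finite_imageI finite_cartesian_product poly_roots_finite) (auto simp: is_min_poly_def)
  moreover have "infinite (range (of_nat :: nat \<Rightarrow> complex))"
    by (rule range_inj_infinite) (simp add: inj_def)
  ultimately obtain n where n: "of_nat n \<notin> ?bad"
    by (meson finite_subset image_subsetI)
  define c where "c = b + of_nat n * a"
  have c: "algebraic_int c"
    using a b unfolding c_def by (intro algebraic_int_plus_times) auto
  then have E: "complex_subfield (rat_extension c)"
    by (intro complex_subfield_rat_extension) blast
  have over: "poly_over (rat_extension c) r" if "poly_over \<rat> r" for r
    using that subfield_Rats[OF E] by (auto simp: poly_over_def)
  have aE: "a \<in> rat_extension c"
  proof (rule common_root_in_subfield[OF E])
    show "poly_over (rat_extension c) (pcompose q [:c, - of_nat n:])"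
      using q over generator_in_rat_extension
      by (intro poly_over_pcompose[OF E])
         (simp_all add: is_min_poly_def poly_over_pCons[OF E] poly_over_0[OF E]
           subfield_uminus[OF E] subfield_of_nat[OF E])
    show "poly_over (rat_extension c) p" using p over by (simp add: is_min_poly_def)
    show "poly (pcompose q [:c, - of_nat n:]) a = 0" "poly p a = 0"
      using p q by (simp_all add: poly_pcompose c_def is_min_poly_def mult.commute)
    show "poly (pderiv p) a \<noteq> 0" by (rule is_min_poly_pderiv[OF p])
    show "z = a" if z: "poly (pcompose q [:c, - of_nat n:]) z = 0" "poly p z = 0" for z
    proof (rule ccontr)
      assume "z \<noteq> a"
      then have "of_nat n = ((c - z * of_nat n) - b) / (a - z)"
        by (simp add: c_def field_simps)
      moreover have "poly q (c - z * of_nat n) = 0" using z(1) by (simp add: poly_pcompose)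
      ultimately show False using n z(2) by (auto simp: image_iff)
    qed
  qed
  moreover have "b = c - of_nat n * a" by (simp add: c_def)
  then have "b \<in> rat_extension c"
    using aE generator_in_rat_extension
    by (simp add: subfield_diff[OF E] subfield_mult[OF E] subfield_of_nat[OF E])
  ultimately show thesis using that c by blast
qed

lemma primitive_element:
  assumes "finite S" and "\<And>s. s \<in> S \<Longrightarrow> algebraic_int s"
  shows "\<exists>a. algebraic_int a \<and> S \<subseteq> rat_extension a"
  using assms
proof (induction S)
  case empty
  then show ?case using algebraic_int_0 by blast
next
  case (insert s S)
  then obtain a where a: "algebraic_int a" "S \<subseteq> rat_extension a" by auto
  obtain c where c: "algebraic_int c" "s \<in> rat_extension c" "a \<in> rat_extension c"
    using primitive_element_of_two insert.prems a(1) by blast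
  have "rat_extension a \<subseteq> rat_extension c"
    using c by (intro rat_extension_subset complex_subfield_rat_extension) auto
  then show ?case using a c by blast
qed

text \<open>The map is total, but only its values on \<open>E\<close> are constrained. One map then serves as an embedding
  of all subfields of \<open>E\<close>.\<close>

definition field_embedding :: "complex set \<Rightarrow> (complex \<Rightarrow> complex) \<Rightarrow> bool" where
  "field_embedding E \<sigma> \<longleftrightarrow> \<sigma> 1 = 1 \<and>
     (\<forall>x\<in>E. \<forall>y\<in>E. \<sigma> (x + y) = \<sigma> x + \<sigma> y \<and> \<sigma> (x * y) = \<sigma> x * \<sigma> y)"

lemma field_embedding_cnj: "field_embedding UNIV cnj"
  by (simp add: field_embedding_def)

text \<open>Sending \<open>P(a)\<close> to \<open>P(z)\<close> does not depend on the choice of \<open>P\<close>: two choices differ by a multiple of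
  the minimal polynomial, which vanishes at \<open>z\<close>.\<close>

lemma field_embedding_conjugate:
  assumes p: "is_min_poly p a" and z: "poly p z = 0"
  obtains \<sigma> where "field_embedding (rat_extension a) \<sigma>"
    and "\<And>P. poly_over \<rat> P \<Longrightarrow> \<sigma> (poly P a) = poly P z"
proof -
  note Q = complex_subfield_Rats
  define \<sigma> where "\<sigma> x = poly (SOME P. poly_over \<rat> P \<and> poly P a = x) z" for x
  have \<sigma>: "\<sigma> (poly P a) = poly P z" if P: "poly_over \<rat> P" for P
  proof -
    define R where "R = (SOME R. poly_over \<rat> R \<and> poly R a = poly P a)"
    have "poly_over \<rat> R \<and> poly R a = poly P a"
      unfolding R_def by (rule someI[of _ P]) (simp add: P)
    then have "p dvd R - P"
      using P by (intro is_min_poly_dvd[OF p] poly_over_diff[OF Q]) auto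
    then have "poly (R - P) z = 0" using z by (metis poly_eq_0_iff_dvd dvd_trans)
    then show ?thesis by (simp add: \<sigma>_def R_def)
  qed
  have "field_embedding (rat_extension a) \<sigma>"
    unfolding field_embedding_def
  proof (intro conjI ballI)
    show "\<sigma> 1 = 1"
      using \<sigma>[OF poly_over_1[OF Q]] by simp
    fix x y assume "x \<in> rat_extension a" "y \<in> rat_extension a"
    then obtain P R where "poly_over \<rat> P" "x = poly P a" "poly_over \<rat> R" "y = poly R a"
      by (auto simp: rat_extension_def)
    then show "\<sigma> (x + y) = \<sigma> x + \<sigma> y" "\<sigma> (x * y) = \<sigma> x * \<sigma> y"
      using \<sigma>[OF poly_over_add[OF Q, of P R]] \<sigma>[OF poly_over_mult[OF Q, of P R]] \<sigma>[of P] \<sigma>[of R]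
      by simp_all
  qed
  then show thesis using that \<sigma> by blast
qed

text \<open>Write \<open>x = R(a)\<close> with \<open>R\<close> shorter than the minimal polynomial \<open>p\<close>. Being fixed means that \<open>R - x\<close>
  vanishes at all roots of \<open>p\<close>. There are as many of these as the degree of \<open>p\<close>, so \<open>R\<close> is the
  constant \<open>x\<close>.\<close>

lemma rational_if_fixed:
  assumes a: "algebraic a" and x: "x \<in> rat_extension a"
    and fixed: "\<And>\<sigma>. field_embedding (rat_extension a) \<sigma> \<Longrightarrow> \<sigma> x = x"
  shows "x \<in> \<rat>"
proof -
  note Q = complex_subfield_Rats
  obtain p where p: "is_min_poly p a" using is_min_poly_exists[OF a] .
  then have "p \<noteq> 0" by (simp add: is_min_poly_def)
  obtain P where P: "poly_over \<rat> P" "x = poly P a" using x by (auto simp: rat_extension_def)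
  define R where "R = P mod p"
  have R: "poly_over \<rat> R" using P p poly_over_div_mod[OF Q] by (simp add: R_def is_min_poly_def)
  have Ra: "poly R a = x"
    using p P(2) by (simp add: R_def minus_div_mult_eq_mod[symmetric] is_min_poly_def)
  have Rz: "poly R z = x" if z: "poly p z = 0" for z
    using field_embedding_conjugate[OF p z] fixed R Ra by metis
  have degR: "Polynomial.degree R < Polynomial.degree p"
    using degree_mod_less[OF \<open>p \<noteq> 0\<close>, of P] is_min_poly_degree_pos[OF p] by (auto simp: R_def)
  have "R - [:x:] = 0"
  proof (rule ccontr)
    assume nz: "R - [:x:] \<noteq> 0"
    have "rsquarefree p"
      unfolding rsquarefree_roots using is_min_poly_conjugate[OF p] is_min_poly_pderiv by blast
    then have "Polynomial.degree p = card {z. poly p z = 0}" by (simp add: rsquarefree_card_roots)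
    also have "\<dots> \<le> card {z. poly (R - [:x:]) z = 0}"
      by (rule card_mono[OF poly_roots_finite[OF nz]]) (auto simp: Rz)
    also have "\<dots> \<le> Polynomial.degree (R - [:x:])" by (rule card_poly_roots_bound[OF nz])
    also have "\<dots> \<le> Polynomial.degree R"
      using degree_diff_le_max[of R "[:x:]"] by simp
    finally show False using degR by simp
  qed
  then have "x = Polynomial.coeff R 0" by (metis coeff_pCons_0 eq_iff_diff_eq_0)
  then show ?thesis using R by (simp add: poly_over_def)
qed

context
  fixes E \<sigma> assumes E: "complex_subfield E" and \<sigma>: "field_embedding E \<sigma>"
begin

lemma embedding_add: "x \<in> E \<Longrightarrow> y \<in> E \<Longrightarrow> \<sigma> (x + y) = \<sigma> x + \<sigma> y"
  and embedding_mult: "x \<in> E \<Longrightarrow> y \<in> E \<Longrightarrow> \<sigma> (x * y) = \<sigma> x * \<sigma> y"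
  and embedding_1: "\<sigma> 1 = 1"
  using \<sigma> by (auto simp: field_embedding_def)

lemma embedding_0: "\<sigma> 0 = 0"
  using embedding_add[of 0 0] subfield_0[OF E] by simp

lemma embedding_uminus: "x \<in> E \<Longrightarrow> \<sigma> (- x) = - \<sigma> x"
  using embedding_add[of x "- x"] subfield_uminus[OF E, of x] embedding_0
  by (simp add: minus_unique)

lemma embedding_diff: "x \<in> E \<Longrightarrow> y \<in> E \<Longrightarrow> \<sigma> (x - y) = \<sigma> x - \<sigma> y"
  using embedding_add[of x "- y"] embedding_uminus[of y] subfield_uminus[OF E, of y] by simp

lemma embedding_inverse:
  assumes "x \<in> E"
  shows "\<sigma> (inverse x) = inverse (\<sigma> x)"
proof (cases "x = 0")
  case False
  then have "\<sigma> x * \<sigma> (inverse x) = 1"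
    using embedding_mult[of x "inverse x"] assms subfield_inverse[OF E assms] embedding_1 by simp
  then show ?thesis by (metis inverse_unique)
qed (simp add: embedding_0)

lemma embedding_eq_0_iff: "x \<in> E \<Longrightarrow> \<sigma> x = 0 \<longleftrightarrow> x = 0"
  using embedding_mult[of x "inverse x"] subfield_inverse[OF E, of x] embedding_1 embedding_0
  by (cases "x = 0") auto

lemma embedding_inj: "inj_on \<sigma> E"
  using embedding_diff embedding_eq_0_iff subfield_diff[OF E] by (intro inj_onI) fastforce

lemma embedding_of_nat: "\<sigma> (of_nat n) = of_nat n"
  by (induction n) (simp_all add: embedding_0 embedding_1 embedding_add subfield_of_nat[OF E] subfield_1[OF E])

lemma embedding_of_int: "\<sigma> (of_int n) = of_int n"
  by (cases n rule: int_cases2) (simp_all add: embedding_of_nat embedding_uminus subfield_of_nat[OF E])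

lemma embedding_Rats:
  assumes "x \<in> \<rat>"
  shows "\<sigma> x = x"
proof -
  obtain a b :: int where "x = of_int a / of_int b" using assms by (auto elim!: Rats_cases')
  then have x: "x = of_int a * inverse (of_int b)" by (simp add: divide_inverse)
  have Z: "of_int n \<in> E" for n by (rule subfield_Rats[OF E]) simp
  show ?thesis
    unfolding x using embedding_mult[OF Z subfield_inverse[OF E Z]] embedding_inverse[OF Z]
    by (simp add: embedding_of_int)
qed

lemma embedding_prod: "(\<And>i. i \<in> I \<Longrightarrow> g i \<in> E) \<Longrightarrow> \<sigma> (prod g I) = (\<Prod>i\<in>I. \<sigma> (g i))"
  by (induction I rule: infinite_finite_induct)
     (auto simp: embedding_1 embedding_mult subfield_prod[OF E])

lemma embedding_poly:
  assumes "poly_over \<rat> P" and x: "x \<in> E"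
  shows "\<sigma> (poly P x) = poly P (\<sigma> x)"
  using assms(1)
proof (induction P)
  case 0
  then show ?case by (simp add: embedding_0)
next
  case (pCons a P)
  then have "a \<in> \<rat>" "poly_over \<rat> P" by (simp_all add: poly_over_pCons[OF complex_subfield_Rats])
  moreover have "poly P x \<in> E"
    using \<open>poly_over \<rat> P\<close> subfield_Rats[OF E] x by (intro poly_over_eval[OF E]) (auto simp: poly_over_def)
  ultimately show ?case
    using pCons.IH x
    by (simp add: embedding_add embedding_mult subfield_mult[OF E] subfield_Rats[OF E] embedding_Rats)
qed

end

section \<open>Field embeddings and the Galois group of a polynomial\<close>

lemma finite_complex_roots: "separable_poly f \<Longrightarrow> finite (complex_roots f)"
  unfolding complex_roots_def separable_poly_def rsquarefree_def
  by (intro poly_roots_finite) auto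

lemma complex_poly_eq_prod_roots:
  assumes "separable_poly f" and "lead_coeff f = 1"
  shows "complex_poly f = (\<Prod>x\<in>complex_roots f. [:- x, 1:])"
  using complex_poly_decompose_rsquarefree[of "complex_poly f"] assms
  by (simp add: separable_poly_def complex_roots_def)

lemma complex_subfield_rat_adjoin: "complex_subfield (rat_adjoin S)"
proof -
  interpret C: Ring.field complex_ring by (rule field_from_type_algebra)
  have "x + y \<in> rat_adjoin S" "x * y \<in> rat_adjoin S"
    if "x \<in> rat_adjoin S" "y \<in> rat_adjoin S" for x y
    using generate_field.eng_add[of x complex_ring _ y] generate_field.eng_mult[of x complex_ring _ y] that
    by (auto simp: rat_adjoin_def ring_of_type_algebra_def)
  moreover have "x \<in> rat_adjoin S" if "x \<in> \<rat>" for x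
    using that by (auto simp: rat_adjoin_def intro: generate_field.incl)
  moreover have "inverse x \<in> rat_adjoin S" if x: "x \<in> rat_adjoin S" for x
  proof (cases "x = 0")
    case False
    have "inv\<^bsub>complex_ring\<^esub> x = inverse x"
      by (rule C.comm_inv_char) (use False in \<open>auto simp: ring_of_type_algebra_def\<close>)
    then show ?thesis
      using generate_field.m_inv[of x complex_ring] x False
      by (auto simp: rat_adjoin_def ring_of_type_algebra_def)
  qed (use x in simp)
  ultimately show ?thesis by (auto simp: complex_subfield_def)
qed

lemma rat_adjoin_superset: "S \<subseteq> rat_adjoin S"
  by (auto simp: rat_adjoin_def intro: generate_field.incl)

lemma rat_adjoin_least:
  assumes E: "complex_subfield E" and "S \<subseteq> E"
  shows "rat_adjoin S \<subseteq> E"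
proof
  interpret C: Ring.field complex_ring by (rule field_from_type_algebra)
  fix x assume "x \<in> rat_adjoin S"
  then have "x \<in> generate_field complex_ring (\<rat> \<union> S)" by (simp add: rat_adjoin_def)
  then show "x \<in> E"
  proof induction
    case one
    then show ?case using subfield_1[OF E] by (simp add: ring_of_type_algebra_def)
  next
    case (incl h)
    then show ?case using assms subfield_Rats[OF E] by auto
  next
    case (a_inv h)
    have "\<ominus>\<^bsub>complex_ring\<^esub> h = - h"
      by (rule C.minus_equality) (auto simp: ring_of_type_algebra_def)
    then show ?case using subfield_uminus[OF E] a_inv by simp
  next
    case (m_inv h)
    have "inv\<^bsub>complex_ring\<^esub> h = inverse h"
      by (rule C.comm_inv_char) (use m_inv in \<open>auto simp: ring_of_type_algebra_def\<close>)
    then show ?case using subfield_inverse[OF E] m_inv by simp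
  next
    case (eng_add a b)
    then show ?case using subfield_add[OF E] by (simp add: ring_of_type_algebra_def)
  next
    case (eng_mult a b)
    then show ?case using subfield_mult[OF E] by (simp add: ring_of_type_algebra_def)
  qed
qed

text \<open>Translates the Galois group from the language of carriers and ring isomorphisms into that of
  embeddings.\<close>

lemma carrier_poly_galois_group:
  "carrier (poly_galois_group f) =
     {\<sigma> \<in> Bij (rat_adjoin (complex_roots f)).
        field_embedding (rat_adjoin (complex_roots f)) \<sigma> \<and> (\<forall>x\<in>\<rat>. \<sigma> x = x)}"
  by (auto simp: poly_galois_group_def galois_group_def ring_iso_def Ring.ring_hom_def Bij_def
      field_embedding_def ring_of_type_algebra_def bij_betw_def)

lemma poly_over_Rats_complex_poly: "poly_over \<rat> (complex_poly f)"
  by (simp add: poly_over_def coeff_map_poly)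

lemma embedding_complex_roots:
  assumes E: "complex_subfield E" and \<sigma>: "field_embedding E \<sigma>"
    and "x \<in> complex_roots f" and "x \<in> E"
  shows "\<sigma> x \<in> complex_roots f"
  using embedding_poly[OF E \<sigma> poly_over_Rats_complex_poly, of x f] assms(3,4) embedding_0[OF E \<sigma>]
  by (simp add: complex_roots_def)

lemma field_embedding_subset:
  "field_embedding E \<sigma> \<Longrightarrow> F \<subseteq> E \<Longrightarrow> field_embedding F \<sigma>"
  by (auto simp: field_embedding_def subset_iff)

lemma embedding_image_subfield:
  assumes E: "complex_subfield E" and \<sigma>: "field_embedding E \<sigma>"
  shows "complex_subfield (\<sigma> ` E)"
proof -
  have "x \<in> \<sigma> ` E" if "x \<in> \<rat>" for x
    using embedding_Rats[OF E \<sigma> that] subfield_Rats[OF E that] by (metis image_eqI)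
  moreover have "x + y \<in> \<sigma> ` E" "x * y \<in> \<sigma> ` E" if "x \<in> \<sigma> ` E" "y \<in> \<sigma> ` E" for x y
    using that embedding_add[OF E \<sigma>] embedding_mult[OF E \<sigma>] subfield_add[OF E] subfield_mult[OF E]
    by (metis (no_types, lifting) image_iff)+
  moreover have "inverse x \<in> \<sigma> ` E" if "x \<in> \<sigma> ` E" for x
    using that embedding_inverse[OF E \<sigma>] subfield_inverse[OF E] by (metis (no_types, lifting) image_iff)
  ultimately show ?thesis by (auto simp: complex_subfield_def)
qed

text \<open>An embedding of any field containing the roots permutes them, hence maps the splitting field onto
  itself. Working in a large field makes it possible to let one embedding act on the roots of two
  polynomials at once without relating their splitting fields.\<close>

lemma restrict_embedding_in_galois_group:
  assumes E: "complex_subfield E" and \<sigma>: "field_embedding E \<sigma>"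
    and f: "separable_poly f" and RE: "complex_roots f \<subseteq> E"
  shows "restrict \<sigma> (rat_adjoin (complex_roots f)) \<in> carrier (poly_galois_group f)"
proof -
  let ?R = "complex_roots f"
  define L where "L = rat_adjoin ?R"
  have L: "complex_subfield L" by (simp add: L_def complex_subfield_rat_adjoin)
  have LE: "L \<subseteq> E" unfolding L_def by (rule rat_adjoin_least[OF E RE])
  have RL: "?R \<subseteq> L" by (simp add: L_def rat_adjoin_superset)
  have \<sigma>L: "field_embedding L \<sigma>" by (rule field_embedding_subset[OF \<sigma> LE])
  have "finite ?R" by (rule finite_complex_roots[OF f])
  moreover have "\<sigma> ` ?R \<subseteq> ?R" using embedding_complex_roots[OF L \<sigma>L] RL by blast
  moreover have "inj_on \<sigma> ?R" using embedding_inj[OF L \<sigma>L] RL by (rule inj_on_subset)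
  ultimately have perm: "\<sigma> ` ?R = ?R" by (rule endo_inj_surj)
  \<comment> \<open>Both \<open>{x \<in> L. \<sigma> x \<in> L}\<close> and \<open>\<sigma> ` L\<close> are fields that contain the roots, so they contain \<open>L\<close>.\<close>
  have "complex_subfield {x \<in> L. \<sigma> x \<in> L}"
    unfolding complex_subfield_def
    using subfield_Rats[OF L] embedding_Rats[OF L \<sigma>L] subfield_add[OF L] subfield_mult[OF L]
      subfield_inverse[OF L] embedding_add[OF L \<sigma>L] embedding_mult[OF L \<sigma>L] embedding_inverse[OF L \<sigma>L]
    by auto
  moreover have "?R \<subseteq> {x \<in> L. \<sigma> x \<in> L}" using perm RL by auto
  ultimately have "L \<subseteq> {x \<in> L. \<sigma> x \<in> L}" unfolding L_def by (rule rat_adjoin_least)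
  moreover have "L \<subseteq> \<sigma> ` L"
    using rat_adjoin_least[OF embedding_image_subfield[OF L \<sigma>L], of ?R] perm RL
    unfolding L_def[symmetric] by blast
  ultimately have "bij_betw \<sigma> L L"
    using embedding_inj[OF L \<sigma>L] by (auto simp: bij_betw_def)
  then have "restrict \<sigma> L \<in> Bij L" by (simp add: Bij_def)
  moreover have "field_embedding L (restrict \<sigma> L)"
    using \<sigma>L subfield_add[OF L] subfield_mult[OF L] subfield_1[OF L]
    by (simp add: field_embedding_def)
  moreover have "\<forall>x\<in>\<rat>. restrict \<sigma> L x = x"
    using embedding_Rats[OF L \<sigma>L] subfield_Rats[OF L] by simp
  ultimately show ?thesis unfolding carrier_poly_galois_group L_def by blast
qed

text \<open>The labelling is the inverse of the bijection in an isomorphism of permutation groups; the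
  permutation attached to an embedding is the image of its restriction under the group isomorphism.\<close>

lemma root_labelling:
  assumes G: "subgroup G (sym_group m)"
    and f: "f \<in> polys_with_galois_group H (perm_subgroup m G) (distinct_tuples m k) (tuple_action m k)"
  obtains \<alpha> where "bij_betw \<alpha> (distinct_tuples m k) (complex_roots f)"
    and "\<And>E \<sigma>. complex_subfield E \<Longrightarrow> field_embedding E \<sigma> \<Longrightarrow> complex_roots f \<subseteq> E \<Longrightarrow>
      \<exists>s. s permutes {1..m} \<and> (\<forall>v\<in>distinct_tuples m k. \<sigma> (\<alpha> v) = \<alpha> (map s v))"
proof -
  let ?R = "complex_roots f" and ?T = "distinct_tuples m k"
  have sep: "separable_poly f" using f by (simp add: polys_with_galois_group_def)
  obtain \<phi> \<psi> where \<phi>: "\<phi> \<in> iso (poly_galois_group f) (perm_subgroup m G)"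
    and \<psi>: "bij_betw \<psi> ?R ?T"
    and eq: "\<And>\<sigma> \<omega>. \<sigma> \<in> carrier (poly_galois_group f) \<Longrightarrow> \<omega> \<in> ?R \<Longrightarrow>
      tuple_action m k (\<phi> \<sigma>) (\<psi> \<omega>) = \<psi> (root_action f \<sigma> \<omega>)"
    using f unfolding polys_with_galois_group_def perm_group_iso_def by blast
  define \<alpha> where "\<alpha> = inv_into ?R \<psi>"
  have bij: "bij_betw \<alpha> ?T ?R" unfolding \<alpha>_def by (rule bij_betw_inv_into[OF \<psi>])
  have "\<exists>s. s permutes {1..m} \<and> (\<forall>v\<in>?T. \<sigma> (\<alpha> v) = \<alpha> (map s v))"
    if E: "complex_subfield E" and \<sigma>: "field_embedding E \<sigma>" and RE: "?R \<subseteq> E" for E \<sigma>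
  proof -
    let ?\<sigma> = "restrict \<sigma> (rat_adjoin ?R)"
    have \<sigma>': "?\<sigma> \<in> carrier (poly_galois_group f)"
      by (rule restrict_embedding_in_galois_group[OF E \<sigma> sep RE])
    define s where "s = \<phi> ?\<sigma>"
    have "s \<in> G" using \<phi> \<sigma>' by (auto simp: s_def iso_def hom_def)
    then have s: "s permutes {1..m}"
      using subgroup.mem_carrier[OF G] by (simp add: sym_group_carrier)
    have "\<sigma> (\<alpha> v) = \<alpha> (map s v)" if v: "v \<in> ?T" for v
    proof -
      have \<alpha>v: "\<alpha> v \<in> ?R" using bij v by (auto simp: bij_betw_def)
      have "\<psi> (\<alpha> v) = v" using \<psi> v by (auto simp: \<alpha>_def bij_betw_def f_inv_into_f)
      then have "map s v = \<psi> (\<sigma> (\<alpha> v))"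
        using eq[OF \<sigma>' \<alpha>v] v \<alpha>v rat_adjoin_superset[of ?R]
        by (auto simp: tuple_action_def root_action_def s_def)
      moreover have "\<sigma> (\<alpha> v) \<in> ?R"
        using embedding_complex_roots[OF E \<sigma> \<alpha>v] RE \<alpha>v by blast
      ultimately show ?thesis using \<psi> by (simp add: \<alpha>_def bij_betw_def)
    qed
    then show ?thesis using s by blast
  qed
  then show thesis using that bij by blast
qed

text \<open>This is where transitivity enters: the Galois group of \<open>f\<close> moves a common root of \<open>f\<close> and \<open>g\<close> to
  every root of \<open>f\<close>, and it preserves the roots of \<open>g\<close>.\<close>

lemma complex_roots_subset_of_common_root:
  assumes trans: "k_transitive m k G"
    and f: "f \<in> polys_with_galois_group H (perm_subgroup m G) (distinct_tuples m k) (tuple_action m k)"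
    and x: "x \<in> complex_roots f" "x \<in> complex_roots g"
  shows "complex_roots f \<subseteq> complex_roots g"
proof
  fix y assume y: "y \<in> complex_roots f"
  let ?R = "complex_roots f" and ?T = "distinct_tuples m k" and ?L = "rat_adjoin (complex_roots f)"
  obtain \<phi> \<psi> where \<phi>: "\<phi> \<in> iso (poly_galois_group f) (perm_subgroup m G)"
    and \<psi>: "bij_betw \<psi> ?R ?T"
    and eq: "\<And>\<sigma> \<omega>. \<sigma> \<in> carrier (poly_galois_group f) \<Longrightarrow> \<omega> \<in> ?R \<Longrightarrow>
      tuple_action m k (\<phi> \<sigma>) (\<psi> \<omega>) = \<psi> (root_action f \<sigma> \<omega>)"
    using f unfolding polys_with_galois_group_def perm_group_iso_def by blast
  interpret transitive_action "perm_subgroup m G" ?T "tuple_action m k"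
    using trans by (simp add: k_transitive_def)
  have "\<psi> x \<in> ?T" "\<psi> y \<in> ?T" using \<psi> x y by (auto simp: bij_betw_def)
  then obtain s where s: "s \<in> carrier (perm_subgroup m G)" "tuple_action m k s (\<psi> x) = \<psi> y"
    using unique_orbit by blast
  then obtain \<sigma> where \<sigma>: "\<sigma> \<in> carrier (poly_galois_group f)" "\<phi> \<sigma> = s"
    using \<phi> by (auto simp: iso_def bij_betw_def)
  have emb: "field_embedding ?L \<sigma>" using \<sigma> by (simp add: carrier_poly_galois_group)
  note L = complex_subfield_rat_adjoin[of ?R]
  have xL: "x \<in> ?L" using x rat_adjoin_superset by blast
  have "\<psi> (\<sigma> x) = \<psi> y" using eq[OF \<sigma>(1) x(1)] \<sigma>(2) s(2) x(1) by (simp add: root_action_def)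
  then have "\<sigma> x = y"
    using \<psi> y embedding_complex_roots[OF L emb x(1) xL] by (auto simp: bij_betw_def inj_on_def)
  then show "y \<in> complex_roots g" using embedding_complex_roots[OF L emb x(2) xL] by simp
qed

section \<open>Counting vectors whose coordinates have bounded product\<close>

lemma sum_powr_int_bounded:
  fixes s :: real
  assumes "1 < s"
  shows "\<exists>Z>0. \<forall>M::nat. (\<Sum>n\<in>{- int M..int M}. max 1 \<bar>real_of_int n\<bar> powr - s) \<le> Z"
proof -
  have sm: "summable (\<lambda>n. real n powr - s)"
    using assms by (simp add: summable_real_powr_iff)
  define Z where "Z = (\<Sum>n. real n powr - s)"
  have part: "(\<Sum>n\<le>M. real n powr - s) \<le> Z" for M
    unfolding Z_def using sum_le_suminf[OF sm, of "{..M}"] by simp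
  have eq: "(\<Sum>n\<in>{- int M..int M}. max 1 \<bar>real_of_int n\<bar> powr - s)
      = 1 + 2 * (\<Sum>n\<le>M. real n powr - s)" for M
  proof (induction M)
    case (Suc M)
    have "{- int (Suc M)..int (Suc M)} = insert (- int (Suc M)) (insert (int (Suc M)) {- int M..int M})"
      by auto
    then show ?case using Suc by (simp del: of_nat_Suc)
  qed simp
  have "0 \<le> Z" using part[of 0] by simp
  then show ?thesis using part unfolding eq by (intro exI[of _ "1 + 2 * Z"]) auto
qed

text \<open>Rankin's trick: every vector to be counted satisfies \<open>1 \<le> (Y / \<Prod>max 1 \<bar>n u\<bar>)\<^sup>s\<close>, and the sum of the
  right-hand sides over a whole box factors into one-dimensional sums. For \<open>s > 1\<close> these are bounded
  by a constant \<open>Z\<close> that does not depend on the box.\<close>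

lemma card_int_vectors_le:
  fixes Y s Z :: real and A :: "'a set"
  assumes "finite A" and "0 < s" and "1 \<le> Y"
    and Z: "\<And>M::nat. (\<Sum>n\<in>{- int M..int M}. max 1 \<bar>real_of_int n\<bar> powr - s) \<le> Z"
    and ext: "\<And>n. n \<in> V \<Longrightarrow> n \<in> extensional A"
    and bound: "\<And>n. n \<in> V \<Longrightarrow> (\<Prod>u\<in>A. max 1 \<bar>real_of_int (n u)\<bar>) \<le> Y"
  shows "real (card V) \<le> Z ^ card A * Y powr s"
proof -
  define M where "M = nat \<lfloor>Y\<rfloor>"
  define w where "w n = max 1 \<bar>real_of_int n\<bar> powr - s" for n
  let ?P = "Pi\<^sub>E A (\<lambda>_. {- int M..int M})"
  have VP: "V \<subseteq> ?P"
  proof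
    fix n assume n: "n \<in> V"
    have "n u \<in> {- int M..int M}" if u: "u \<in> A" for u
    proof -
      have "\<bar>real_of_int (n u)\<bar> \<le> max 1 \<bar>real_of_int (n u)\<bar>" by simp
      also have "\<dots> \<le> max 1 \<bar>real_of_int (n u)\<bar> * (\<Prod>u'\<in>A - {u}. max 1 \<bar>real_of_int (n u')\<bar>)"
        by (intro mult_le_cancel_left1[THEN iffD2]) (auto intro!: prod_ge_1)
      also have "\<dots> = (\<Prod>u\<in>A. max 1 \<bar>real_of_int (n u)\<bar>)"
        by (rule prod.remove[OF assms(1) u, symmetric])
      also have "\<dots> \<le> Y" by (rule bound[OF n])
      finally have "\<bar>n u\<bar> \<le> \<lfloor>Y\<rfloor>" by linarith
      then show ?thesis using assms(3) by (auto simp: M_def abs_le_iff)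
    qed
    then show "n \<in> ?P" using ext[OF n] by (auto simp: PiE_def)
  qed
  have finP: "finite ?P" using assms(1) by (intro finite_PiE) auto
  have w: "(\<Prod>u\<in>A. w (n u)) = (\<Prod>u\<in>A. max 1 \<bar>real_of_int (n u)\<bar>) powr - s" for n
    unfolding w_def by (rule prod_powr_distrib[symmetric])
  have "real (card V) = (\<Sum>n\<in>V. 1)" by simp
  also have "\<dots> \<le> (\<Sum>n\<in>V. Y powr s * (\<Prod>u\<in>A. w (n u)))"
  proof (rule sum_mono)
    fix n assume n: "n \<in> V"
    \<comment> \<open>The weight of each vector in \<open>V\<close> is at least \<open>1\<close>.\<close>
    let ?p = "\<Prod>u\<in>A. max 1 \<bar>real_of_int (n u)\<bar>"
    have "1 \<le> ?p" by (intro prod_ge_1) auto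
    then have "1 = ?p powr s * ?p powr - s" by (simp add: powr_minus)
    also have "\<dots> \<le> Y powr s * ?p powr - s"
      using bound[OF n] \<open>1 \<le> ?p\<close> assms(2) by (intro mult_right_mono powr_mono2) auto
    finally show "1 \<le> Y powr s * (\<Prod>u\<in>A. w (n u))" by (simp add: w)
  qed
  also have "\<dots> \<le> (\<Sum>n\<in>?P. Y powr s * (\<Prod>u\<in>A. w (n u)))"
    using VP finP by (intro sum_mono2) (auto simp: w_def intro!: mult_nonneg_nonneg prod_nonneg)
  also have "\<dots> = Y powr s * (\<Prod>u\<in>A. \<Sum>n\<in>{- int M..int M}. w n)"
    using assms(1) by (subst prod_sum_PiE) (simp_all add: sum_distrib_left)
  also have "\<dots> \<le> Y powr s * (\<Prod>u\<in>A. Z)"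
    using Z by (intro mult_left_mono prod_mono) (auto simp: w_def intro!: sum_nonneg)
  finally show "real (card V) \<le> Z ^ card A * Y powr s" by (simp add: mult.commute)
qed

text \<open>A box counting argument that is uniform in the number field. The entries at \<open>u\<close> and \<open>c u\<close> are
  complex conjugate, so the numbers \<open>Re + Im\<close> at \<open>u\<close> and at \<open>c u\<close> are \<open>Re + Im\<close> and \<open>Re - Im\<close> of the same
  entry: one real number per index determines the vector. Rounding each of them down loses less than
  \<open>1\<close>, and if two vectors round to the same integers, the identity
  \<open>(Re + Im)\<^sup>2 + (Re - Im)\<^sup>2 = 2 \<bar>\<cdot>\<bar>\<^sup>2\<close> makes all entries of their difference smaller than \<open>1\<close>, against
  the separation hypothesis. So it suffices to count integer vectors.\<close>

lemma card_separated_conjugate_vectors_le: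
  fixes Y s Z :: real and A :: "'a set" and a :: "'f \<Rightarrow> 'a \<Rightarrow> complex"
  assumes A: "finite A" "A \<noteq> {}" and s: "0 < s" and Y: "1 \<le> Y"
    and Z: "\<And>M::nat. (\<Sum>n\<in>{- int M..int M}. max 1 \<bar>real_of_int n\<bar> powr - s) \<le> Z"
    and c: "\<And>u. u \<in> A \<Longrightarrow> c u \<in> A"
    and conj: "\<And>f u. f \<in> F \<Longrightarrow> u \<in> A \<Longrightarrow> a f (c u) = cnj (a f u)"
    and bound: "\<And>f. f \<in> F \<Longrightarrow> (\<Prod>u\<in>A. max 1 (cmod (a f u))) \<le> Y"
    and sep: "\<And>f g. f \<in> F \<Longrightarrow> g \<in> F \<Longrightarrow> f \<noteq> g \<Longrightarrow> 1 \<le> (\<Prod>u\<in>A. cmod (a f u - a g u))"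
  shows "real (card F) \<le> Z ^ card A * (3 ^ card A * Y) powr s"
proof -
  define b where "b f u = Re (a f u) + Im (a f u)" for f u
  define n where "n f = restrict (\<lambda>u. \<lfloor>b f u\<rfloor>) A" for f
  have "inj_on n F"
  proof (rule inj_onI, rule ccontr)
    fix f g assume fg: "f \<in> F" "g \<in> F" "n f = n g" "f \<noteq> g"
    have close: "\<bar>b f u - b g u\<bar> < 1" if "u \<in> A" for u
    proof -
      have "\<lfloor>b f u\<rfloor> = \<lfloor>b g u\<rfloor>" using fun_cong[OF fg(3), of u] that by (simp add: n_def)
      then show ?thesis by linarith
    qed
    have lt1: "cmod (a f u - a g u) < 1" if u: "u \<in> A" for u
    proof -
      define d where "d = a f u - a g u"
      have "\<bar>Re d + Im d\<bar> < 1" using close[OF u] by (simp add: b_def d_def algebra_simps)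
      moreover have "\<bar>Re d - Im d\<bar> < 1"
        using close[OF c[OF u]] conj[OF fg(1) u] conj[OF fg(2) u]
        by (simp add: b_def d_def algebra_simps)
      ultimately have "(Re d + Im d)\<^sup>2 < 1" "(Re d - Im d)\<^sup>2 < 1"
        by (simp_all add: abs_square_less_1)
      then have "(cmod d)\<^sup>2 < 1"
        unfolding cmod_power2 by (simp add: power2_eq_square algebra_simps)
      then show ?thesis by (simp add: d_def abs_square_less_1)
    qed
    \<comment> \<open>A product of nonnegative factors below \<open>1\<close> is below \<open>1\<close> as soon as there is a factor.\<close>
    obtain u where u: "u \<in> A" using A(2) by blast
    have "(\<Prod>u\<in>A. cmod (a f u - a g u))
        = cmod (a f u - a g u) * (\<Prod>u'\<in>A - {u}. cmod (a f u' - a g u'))"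
      by (rule prod.remove[OF A(1) u])
    also have "\<dots> \<le> cmod (a f u - a g u) * 1"
      using lt1 by (intro mult_left_mono prod_le_1) (auto intro: less_imp_le)
    finally show False using lt1[OF u] sep[OF fg(1,2,4)] by simp
  qed
  moreover have "real (card (n ` F)) \<le> Z ^ card A * (3 ^ card A * Y) powr s"
  proof (rule card_int_vectors_le[OF A(1) s _ Z])
    show "1 \<le> 3 ^ card A * Y" using Y by (metis mult_mono one_le_power one_le_numeral mult_1 zero_le_one zero_le_power zero_le_numeral)
    show "v \<in> extensional A" if "v \<in> n ` F" for v using that by (auto simp: n_def)
    show "(\<Prod>u\<in>A. max 1 \<bar>real_of_int (v u)\<bar>) \<le> 3 ^ card A * Y" if v: "v \<in> n ` F" for v
    proof -
      obtain f where f: "f \<in> F" "v = n f" using v by blast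
      have "(\<Prod>u\<in>A. max 1 \<bar>real_of_int (v u)\<bar>) \<le> (\<Prod>u\<in>A. 3 * max 1 (cmod (a f u)))"
      proof (rule prod_mono, intro conjI)
        fix u assume "u \<in> A"
        have "\<bar>real_of_int \<lfloor>b f u\<rfloor>\<bar> \<le> \<bar>b f u\<bar> + 1" by linarith
        also have "\<dots> \<le> 2 * cmod (a f u) + 1"
          using abs_Re_le_cmod[of "a f u"] abs_Im_le_cmod[of "a f u"] unfolding b_def by linarith
        finally show "max 1 \<bar>real_of_int (v u)\<bar> \<le> 3 * max 1 (cmod (a f u))"
          using \<open>u \<in> A\<close> by (auto simp: f n_def)
      qed simp
      also have "\<dots> = 3 ^ card A * (\<Prod>u\<in>A. max 1 (cmod (a f u)))"
        by (simp add: prod.distrib)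
      also have "\<dots> \<le> 3 ^ card A * Y" using bound[OF f(1)] by simp
      finally show ?thesis .
    qed
  qed
  ultimately show ?thesis by (simp add: card_image)
qed

text \<open>Two monic polynomials of degree \<open>m\<close> that agree at \<open>m\<close> points are equal, since their difference has
  degree less than \<open>m\<close>.\<close>

lemma prod_linear_eqD:
  fixes S S' :: "'a::idom set"
  assumes S: "finite S" "finite S'" "card S = m" "card S' = m"
    and J: "finite J" "card J = m"
    and eq: "\<And>j. j \<in> J \<Longrightarrow> (\<Prod>x\<in>S. j - x) = (\<Prod>x\<in>S'. j - x)"
  shows "S = S'"
proof -
  define P where "P S = (\<Prod>x\<in>S. [:- x, 1:])" for S :: "'a set"
  have roots: "{z. poly (P S) z = 0} = S" if "finite S" for S
    using that by (auto simp: P_def poly_prod)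
  have deg: "Polynomial.degree (P S) = card S" for S
    by (simp add: P_def degree_prod_eq_sum_degree)
  have mon: "lead_coeff (P S) = 1" for S
    by (simp add: P_def lead_coeff_prod)
  have "P S = P S'"
  proof (rule ccontr)
    assume neq: "P S \<noteq> P S'"
    then have nz: "P S - P S' \<noteq> 0" by simp
    have "m = card J" using J by simp
    also have "\<dots> \<le> card {z. poly (P S - P S') z = 0}"
      using eq by (intro card_mono poly_roots_finite[OF nz]) (auto simp: P_def poly_prod)
    also have "\<dots> \<le> Polynomial.degree (P S - P S')" by (rule card_poly_roots_bound[OF nz])
    finally have "m \<le> Polynomial.degree (P S - P S')" .
    moreover have "Polynomial.degree (P S - P S') \<le> m"
      using degree_diff_le_max[of "P S" "P S'"] S deg by simp
    ultimately have "Polynomial.degree (P S - P S') = m" by simp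
    moreover have "Polynomial.coeff (P S - P S') m = 0"
      using mon[of S] mon[of S'] deg S by simp
    ultimately have "lead_coeff (P S - P S') = 0" by (simp only:)
    then show False using nz leading_coeff_0_iff by blast
  qed
  then show ?thesis using roots S by metis
qed

lemma card_sets_integral_values_le:
  fixes B :: real and \<S> :: "'a::{idom, ring_char_0} set set"
  assumes "0 \<le> B"
    and fin: "\<And>S. S \<in> \<S> \<Longrightarrow> finite S \<and> card S = m"
    and vals: "\<And>S j. S \<in> \<S> \<Longrightarrow> j \<in> {1..m} \<Longrightarrow>
      \<exists>z::int. (\<Prod>x\<in>S. of_nat j - x) = of_int z \<and> \<bar>real_of_int z\<bar> \<le> B"
  shows "real (card \<S>) \<le> (2 * B + 1) ^ m"
proof -
  obtain z :: "'a set \<Rightarrow> nat \<Rightarrow> int" where z: "\<And>S j. S \<in> \<S> \<Longrightarrow> j \<in> {1..m} \<Longrightarrow>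
      (\<Prod>x\<in>S. of_nat j - x) = of_int (z S j) \<and> \<bar>real_of_int (z S j)\<bar> \<le> B"
    using vals by metis
  let ?P = "Pi\<^sub>E {1..m} (\<lambda>_. {- \<lfloor>B\<rfloor>..\<lfloor>B\<rfloor>})"
  define n where "n S = restrict (z S) {1..m}" for S
  have inj: "inj_on n \<S>"
  proof (rule inj_onI)
    fix S S' assume S: "S \<in> \<S>" "S' \<in> \<S>" "n S = n S'"
    show "S = S'"
    proof (rule prod_linear_eqD)
      show "card (of_nat ` {1..m} :: 'a set) = m"
        by (subst card_image) (auto simp: inj_on_def)
      show "(\<Prod>x\<in>S. j - x) = (\<Prod>x\<in>S'. j - x)" if j: "j \<in> of_nat ` {1..m}" for j
      proof -
        obtain i where i: "i \<in> {1..m}" "j = of_nat i" using j by blast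
        then have "z S i = z S' i" using fun_cong[OF S(3), of i] by (simp add: n_def)
        then show ?thesis using z[OF S(1) i(1)] z[OF S(2) i(1)] i(2) by simp
      qed
    qed (use S fin in auto)
  qed
  have sub: "n ` \<S> \<subseteq> ?P"
  proof -
    have "z S j \<in> {- \<lfloor>B\<rfloor>..\<lfloor>B\<rfloor>}" if "S \<in> \<S>" "j \<in> {1..m}" for S j
      using z[OF that] by (simp add: abs_le_iff) linarith
    then show ?thesis by (auto simp: n_def)
  qed
  have finP: "finite ?P" by (intro finite_PiE) auto
  have "card \<S> \<le> card ?P" by (rule card_inj_on_le[OF inj sub finP])
  also have "\<dots> = nat (2 * \<lfloor>B\<rfloor> + 1) ^ m" using assms(1) by (simp add: card_PiE algebra_simps)
  finally have "real (card \<S>) \<le> real (nat (2 * \<lfloor>B\<rfloor> + 1) ^ m)" by (rule of_nat_mono)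
  also have "\<dots> = real (nat (2 * \<lfloor>B\<rfloor> + 1)) ^ m" by simp
  also have "\<dots> \<le> (2 * B + 1) ^ m"
  proof (rule power_mono)
    show "real (nat (2 * \<lfloor>B\<rfloor> + 1)) \<le> 2 * B + 1" using assms(1) by linarith
  qed (rule of_nat_0_le_iff)
  finally show "real (card \<S>) \<le> (2 * B + 1) ^ m" .
qed

section \<open>Landau's inequality\<close>

text \<open>The left-hand side is the Mahler measure of \<open>f\<close>, which Landau's inequality bounds by the Euclidean
  norm of the coefficients.\<close>

lemma prod_roots_le:
  assumes f: "f \<in> monic_polys n H" and sep: "separable_poly f" and "1 \<le> H"
  shows "(\<Prod>x\<in>complex_roots f. max 1 (cmod x)) \<le> (real n + 1) * H"
proof -
  have mon: "lead_coeff f = 1" and deg: "Polynomial.degree f = n" and ht: "real_of_int (poly_height f) \<le> H"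
    using f by (auto simp: monic_polys_def)
  obtain rs where rs: "set rs = complex_roots f" "distinct rs"
    using finite_distinct_list[OF finite_complex_roots[OF sep]] by blast
  have "complex_poly f = (\<Prod>x\<in>complex_roots f. [:- x, 1:])"
    by (rule complex_poly_eq_prod_roots[OF sep mon])
  also have "\<dots> = Polynomial.smult 1 (\<Prod>x\<leftarrow>rs. [:- x, 1:])"
    unfolding rs(1)[symmetric] using prod.distinct_set_conv_list[OF rs(2)] by simp
  finally have "complex_poly f = Polynomial.smult 1 (\<Prod>x\<leftarrow>rs. [:- x, 1:])" .
  then have "mahler_measure f = (\<Prod>x\<leftarrow>rs. max 1 (cmod x))"
    by (simp only: mahler_measure_def mahler_measure_poly_explicit) simp
  also have "\<dots> = (\<Prod>x\<in>complex_roots f. max 1 (cmod x))"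
    unfolding rs(1)[symmetric] by (rule prod.distinct_set_conv_list[OF rs(2), symmetric])
  finally have "(\<Prod>x\<in>complex_roots f. max 1 (cmod x)) \<le> sqrt (real_of_int (\<Sum>a\<leftarrow>coeffs f. a * a))"
    using Landau_inequality_mahler_measure[of f] by simp
  also have "real_of_int (\<Sum>a\<leftarrow>coeffs f. a * a) = (\<Sum>i\<le>n. (real_of_int (Polynomial.coeff f i))\<^sup>2)"
    using mon deg
    by (auto simp: coeffs_def comp_def power2_eq_square atMost_upto interv_sum_list_conv_sum_set_nat
        simp flip: atLeast0AtMost simp del: upt_Suc)
  also have "\<dots> \<le> (\<Sum>i\<le>n. H\<^sup>2)"
  proof (rule sum_mono)
    fix i assume i: "i \<in> {..n}"
    have "\<bar>Polynomial.coeff f i\<bar> \<le> poly_height f"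
      unfolding poly_height_def using i deg by (intro Max_ge) auto
    then have "\<bar>real_of_int (Polynomial.coeff f i)\<bar> \<le> H" using ht by linarith
    then show "(real_of_int (Polynomial.coeff f i))\<^sup>2 \<le> H\<^sup>2" by (rule abs_le_square_iff[THEN iffD1, OF order.trans]) simp
  qed
  also have "\<dots> = (real n + 1) * H\<^sup>2" by simp
  also have "sqrt \<dots> \<le> sqrt (((real n + 1) * H)\<^sup>2)"
    unfolding power_mult_distrib
    by (intro real_sqrt_le_mono mult_right_mono self_le_power) auto
  also have "\<dots> = (real n + 1) * H" using assms(3) by simp
  finally show ?thesis by simp
qed

section \<open>Labelling the roots by tuples of resolvent values\<close>

definition index_tuples :: "nat \<Rightarrow> 'a set \<Rightarrow> 'a list set" where
  "index_tuples k \<Gamma> = {u. length u = k \<and> set u \<subseteq> \<Gamma> \<and> distinct u}"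

lemma distinct_tuples_eq_index_tuples: "distinct_tuples m k = index_tuples k {1..m}"
  by (auto simp: distinct_tuples_def index_tuples_def)

lemma finite_index_tuples: "finite \<Gamma> \<Longrightarrow> finite (index_tuples k \<Gamma>)"
  unfolding index_tuples_def
  by (rule finite_subset[OF _ finite_lists_length_eq[of \<Gamma> k]]) auto

lemma bij_betw_map_index_tuples:
  assumes "bij_betw g \<Gamma> \<Delta>"
  shows "bij_betw (map g) (index_tuples k \<Gamma>) (index_tuples k \<Delta>)"
proof (rule bij_betw_byWitness[where f' = "map (inv_into \<Gamma> g)"])
  have inj: "inj_on g \<Gamma>" and im: "g ` \<Gamma> = \<Delta>" using assms by (auto simp: bij_betw_def)
  have inj': "inj_on (inv_into \<Gamma> g) \<Delta>" using im inj_on_inv_into[of \<Delta> g \<Gamma>] by simp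
  show "\<forall>u\<in>index_tuples k \<Gamma>. map (inv_into \<Gamma> g) (map g u) = u"
    using inj by (auto simp: index_tuples_def subset_iff inv_into_f_f intro!: map_idI)
  show "\<forall>u\<in>index_tuples k \<Delta>. map g (map (inv_into \<Gamma> g) u) = u"
    using im by (auto simp: index_tuples_def subset_iff f_inv_into_f intro!: map_idI)
  show "map g ` index_tuples k \<Gamma> \<subseteq> index_tuples k \<Delta>"
    using im inj by (auto simp: index_tuples_def distinct_map intro: inj_on_subset; blast)
  show "map (inv_into \<Gamma> g) ` index_tuples k \<Delta> \<subseteq> index_tuples k \<Gamma>"
    using im inj' by (auto simp: index_tuples_def distinct_map intro: inj_on_subset; meson inv_into_into subsetD)
qed

lemma index_tuples_hd_exists:
  assumes "finite \<Gamma>" and "x \<in> \<Gamma>" and "1 \<le> k" and "k \<le> card \<Gamma>"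
  shows "\<exists>u\<in>index_tuples k \<Gamma>. hd u = x"
proof -
  have "k - 1 \<le> card (\<Gamma> - {x})" using assms by simp
  then obtain \<Delta> where \<Delta>: "\<Delta> \<subseteq> \<Gamma> - {x}" "card \<Delta> = k - 1" "finite \<Delta>"
    by (meson obtain_subset_with_card_n)
  then obtain us where us: "set us = \<Delta>" "distinct us" using finite_distinct_list by blast
  then have "x # us \<in> index_tuples k \<Gamma>"
    using \<Delta> assms distinct_card[OF us(2)] by (auto simp: index_tuples_def)
  then show ?thesis by (metis list.sel(1))
qed

text \<open>The set \<open>\<Gamma>\<close> replaces \<open>{1..m}\<close>. Since it consists of complex numbers, an embedding acts on the tuples
  over \<open>\<Gamma>\<close> directly, with no reference to a Galois group. Labellings of different polynomials over
  the same \<open>\<Gamma>\<close> are therefore moved by the same permutation of tuples.\<close>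

definition compatible_labelling ::
    "nat \<Rightarrow> int poly \<Rightarrow> complex set \<Rightarrow> (complex list \<Rightarrow> complex) \<Rightarrow> bool" where
  "compatible_labelling k f \<Gamma> a \<longleftrightarrow> finite \<Gamma> \<and> bij_betw a (index_tuples k \<Gamma>) (complex_roots f) \<and>
     (\<forall>E \<sigma>. complex_subfield E \<longrightarrow> field_embedding E \<sigma> \<longrightarrow> complex_roots f \<subseteq> E \<longrightarrow>
        bij_betw \<sigma> \<Gamma> \<Gamma> \<and> (\<forall>u\<in>index_tuples k \<Gamma>. \<sigma> (a u) = a (map \<sigma> u)))"

text \<open>The polynomials \<open>P i = \<Prod>v\<in>D i. X - \<alpha> v\<close> have disjoint sets of roots, so the differences of two of
  them are nonzero and together have at most \<open>card I * card I * N\<close> roots. One of the integers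
  \<open>0, \<dots>, card I * card I * N\<close> avoids all of them. What matters is that this range depends neither on
  \<open>\<alpha>\<close> nor on the height.\<close>

lemma separating_translate:
  fixes \<alpha> :: "'v \<Rightarrow> 'a::field_char_0" and D :: "'i \<Rightarrow> 'v set"
  assumes I: "finite I" and D: "\<And>i. i \<in> I \<Longrightarrow> finite (D i) \<and> D i \<noteq> {} \<and> card (D i) \<le> N"
    and disj: "\<And>i j. i \<in> I \<Longrightarrow> j \<in> I \<Longrightarrow> i \<noteq> j \<Longrightarrow> D i \<inter> D j = {}"
    and inj: "inj_on \<alpha> (\<Union>i\<in>I. D i)"
  shows "\<exists>t \<le> card I * card I * N. inj_on (\<lambda>i. \<Prod>v\<in>D i. of_nat t - \<alpha> v) I"
proof (rule ccontr)
  assume contra: "\<not> ?thesis"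
  define P where "P i = (\<Prod>v\<in>D i. [:- \<alpha> v, 1:])" for i
  define pairs where "pairs = {p \<in> I \<times> I. fst p \<noteq> snd p}"
  define bad where "bad = (\<Union>(i, j)\<in>pairs. {z. poly (P i - P j) z = 0})"
  let ?M = "card I * card I * N"
  have fin: "finite pairs" using I by (auto simp: pairs_def)
  have roots: "poly (P i) (\<alpha> v) = 0 \<longleftrightarrow> v \<in> D i" if "i \<in> I" "v \<in> (\<Union>i\<in>I. D i)" for i v
    using that D inj by (auto simp: P_def poly_prod inj_on_def) blast
  have nz: "P i - P j \<noteq> 0" if ij: "(i, j) \<in> pairs" for i j
  proof
    assume "P i - P j = 0"
    moreover obtain v where v: "v \<in> D i" using D ij by (fastforce simp: pairs_def)
    moreover have "v \<notin> D j" using disj[of i j] v ij by (auto simp: pairs_def)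
    ultimately show False using roots[of i v] roots[of j v] ij by (auto simp: pairs_def)
  qed
  have root_card: "card {z. poly (P i - P j) z = 0} \<le> N" if ij: "(i, j) \<in> pairs" for i j
  proof -
    have "card {z. poly (P i - P j) z = 0} \<le> Polynomial.degree (P i - P j)"
      by (rule card_poly_roots_bound[OF nz[OF ij]])
    also have "\<dots> \<le> max (Polynomial.degree (P i)) (Polynomial.degree (P j))"
      by (rule degree_diff_le_max)
    also have "\<dots> \<le> N" using D ij by (auto simp: P_def pairs_def degree_prod_eq_sum_degree)
    finally show ?thesis .
  qed
  have "card bad \<le> (\<Sum>(i, j)\<in>pairs. card {z. poly (P i - P j) z = 0})"
    unfolding bad_def by (rule order.trans[OF card_UN_le[OF fin]]) (simp add: case_prod_beta)
  also have "\<dots> \<le> (\<Sum>p\<in>pairs. N)" using root_card by (intro sum_mono) auto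
  also have "\<dots> = card pairs * N" by simp
  also have "card pairs \<le> card (I \<times> I)" using I by (intro card_mono) (auto simp: pairs_def)
  finally have "card bad \<le> ?M" by (simp add: card_cartesian_product)
  have "finite bad"
    unfolding bad_def
  proof (rule finite_UN_I[OF fin])
    fix p assume "p \<in> pairs"
    then show "finite (case p of (i, j) \<Rightarrow> {z. poly (P i - P j) z = 0})"
      by (cases p) (simp only: prod.case poly_roots_finite[OF nz])
  qed
  have "of_nat t \<in> bad" if "t \<le> ?M" for t
  proof -
    have "\<not> inj_on (\<lambda>i. \<Prod>v\<in>D i. of_nat t - \<alpha> v) I" using contra that by blast
    then obtain i j where ij: "i \<in> I" "j \<in> I" "i \<noteq> j"
      "(\<Prod>v\<in>D i. of_nat t - \<alpha> v) = (\<Prod>v\<in>D j. of_nat t - \<alpha> v)"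
      unfolding inj_on_def by blast
    then have "(i, j) \<in> pairs" by (simp add: pairs_def)
    moreover have "poly (P i - P j) (of_nat t) = 0" using ij(4) by (simp add: P_def poly_prod)
    ultimately show ?thesis unfolding bad_def by blast
  qed
  then have "(of_nat ` {..?M} :: 'a set) \<subseteq> bad" by auto
  then have "card (of_nat ` {..?M} :: 'a set) \<le> card bad" by (rule card_mono[OF \<open>finite bad\<close>])
  moreover have "card (of_nat ` {..?M} :: 'a set) = Suc ?M"
    by (subst card_image) (auto simp: inj_on_def)
  ultimately show False using \<open>card bad \<le> ?M\<close> by simp
qed

lemma algebraic_int_complex_roots:
  assumes "lead_coeff f = 1" and "x \<in> complex_roots f"
  shows "algebraic_int x"
  unfolding algebraic_int_altdef_ipoly
  by (rule exI[of _ f]) (use assms in \<open>simp add: complex_roots_def\<close>)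

text \<open>Applied to expressions in the roots \<open>S\<close> of one or two polynomials, which lie in every field that
  contains \<open>S\<close>; the field in which the fixed element is rational is generated by a primitive element
  for \<open>S\<close>.\<close>

lemma integer_if_fixed:
  assumes S: "finite S" "\<And>s. s \<in> S \<Longrightarrow> algebraic_int s" and x: "algebraic_int x"
    and "\<And>E. complex_subfield E \<Longrightarrow> S \<subseteq> E \<Longrightarrow> x \<in> E"
    and fixed: "\<And>E \<sigma>. complex_subfield E \<Longrightarrow> field_embedding E \<sigma> \<Longrightarrow> S \<subseteq> E \<Longrightarrow> \<sigma> x = x"
  shows "x \<in> \<int>"
proof -
  obtain \<theta> where \<theta>: "algebraic_int \<theta>" "S \<subseteq> rat_extension \<theta>"
    using primitive_element[OF S] by blast
  have E: "complex_subfield (rat_extension \<theta>)"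
    using \<theta>(1) by (intro complex_subfield_rat_extension) blast
  have "x \<in> \<rat>"
    using assms(4)[OF E \<theta>(2)] fixed[OF E _ \<theta>(2)] \<theta>(1) by (intro rational_if_fixed) auto
  then show ?thesis using x by (intro rational_algebraic_int_is_int)
qed

text \<open>Group the roots by the first entry \<open>i\<close> of their label and let \<open>\<gamma> i\<close> be the product of \<open>t - \<alpha> v\<close> over
  the \<open>i\<close>-th group. Embeddings permute the \<open>\<gamma> i\<close> as they permute the indices \<open>i\<close>, so once \<open>t\<close> is chosen
  to make the \<open>\<gamma> i\<close> distinct, they can take over the role of the indices. Every root enters exactly
  one \<open>\<gamma> i\<close>, hence the product of the numbers \<open>max 1 \<bar>\<gamma> i\<bar>\<close> is at most a constant times the Mahler
  measure of \<open>f\<close>. This makes the values at \<open>1, \<dots>, m\<close> of the polynomial with roots \<open>\<gamma> i\<close> integers of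
  size linear in \<open>H\<close>.\<close>

lemma compatible_labelling_exists:
  fixes H :: real
  assumes k: "1 \<le> k" "k \<le> m" and G: "subgroup G (sym_group m)" and H: "1 \<le> H"
    and f: "f \<in> polys_with_galois_group H (perm_subgroup m G) (distinct_tuples m k) (tuple_action m k)"
    and N: "N = card (distinct_tuples m k)"
  shows "\<exists>\<Gamma> a. compatible_labelling k f \<Gamma> a \<and> card \<Gamma> = m \<and>
    (\<forall>j\<in>{1..m}. \<exists>z::int. (\<Prod>x\<in>\<Gamma>. of_nat j - x) = of_int z \<and>
       \<bar>real_of_int z\<bar> \<le> (real m + 1) ^ m * (real (m * m * N) + 1) ^ N * (real N + 1) * H)"
proof -
  let ?T = "distinct_tuples m k" and ?R = "complex_roots f"
  have T: "?T = index_tuples k {1..m}" by (rule distinct_tuples_eq_index_tuples)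
  have finT: "finite ?T" unfolding T by (rule finite_index_tuples) simp
  have sep: "separable_poly f" and monic: "f \<in> monic_polys N H" and lead: "lead_coeff f = 1"
    using f by (auto simp: polys_with_galois_group_def monic_polys_def N)
  have finR: "finite ?R" by (rule finite_complex_roots[OF sep])
  obtain \<alpha> where \<alpha>: "bij_betw \<alpha> ?T ?R"
    and equiv: "\<And>E \<sigma>. complex_subfield E \<Longrightarrow> field_embedding E \<sigma> \<Longrightarrow> ?R \<subseteq> E \<Longrightarrow>
      \<exists>s. s permutes {1..m} \<and> (\<forall>v\<in>?T. \<sigma> (\<alpha> v) = \<alpha> (map s v))"
    using root_labelling[OF G f] by metis
  define D where "D i = {v \<in> ?T. hd v = i}" for i
  have finD: "finite (D i)" for i using finT by (simp add: D_def)
  have hd_in: "hd v \<in> {1..m}" if "v \<in> ?T" for v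
    using that k by (cases v) (auto simp: distinct_tuples_def)
  have UD: "(\<Union>i\<in>{1..m}. D i) = ?T" using hd_in by (auto simp: D_def)
  have cardD: "card (D i) \<le> N" for i
    unfolding N by (rule card_mono[OF finT]) (auto simp: D_def)
  have "\<exists>t \<le> card {1..m} * card {1..m} * N. inj_on (\<lambda>i. \<Prod>v\<in>D i. of_nat t - \<alpha> v) {1..m}"
  proof (rule separating_translate)
    fix i assume "i \<in> {1..m}"
    then have "D i \<noteq> {}"
      using index_tuples_hd_exists[of "{1..m}" i k] k by (auto simp: D_def T)
    then show "finite (D i) \<and> D i \<noteq> {} \<and> card (D i) \<le> N" using finD cardD by simp
  next
    show "inj_on \<alpha> (\<Union>i\<in>{1..m}. D i)" unfolding UD using \<alpha> by (simp add: bij_betw_def)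
  qed (auto simp: D_def)
  then obtain t where t: "t \<le> m * m * N"
    and inj: "inj_on (\<lambda>i. \<Prod>v\<in>D i. of_nat t - \<alpha> v) {1..m}" by auto
  define \<gamma> where "\<gamma> i = (\<Prod>v\<in>D i. of_nat t - \<alpha> v)" for i
  define \<Gamma> where "\<Gamma> = \<gamma> ` {1..m}"
  define g where "g = inv_into {1..m} \<gamma>"
  define a where "a u = \<alpha> (map g u)" for u
  have \<gamma>: "bij_betw \<gamma> {1..m} \<Gamma>" using inj by (simp add: \<gamma>_def[abs_def] \<Gamma>_def bij_betw_def)
  have g: "bij_betw g \<Gamma> {1..m}" unfolding g_def by (rule bij_betw_inv_into[OF \<gamma>])
  have g\<gamma>: "g (\<gamma> i) = i" if "i \<in> {1..m}" for i
    using \<gamma> that by (simp add: g_def bij_betw_def)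
  have \<gamma>g: "\<gamma> (g x) = x" if "x \<in> \<Gamma>" for x
    using that by (simp add: g_def \<Gamma>_def f_inv_into_f)
  have fin\<Gamma>: "finite \<Gamma>" and card\<Gamma>: "card \<Gamma> = m"
    using bij_betw_same_card[OF \<gamma>] by (simp_all add: \<Gamma>_def)
  have aT: "bij_betw a (index_tuples k \<Gamma>) ?R"
    using bij_betw_trans[OF bij_betw_map_index_tuples[OF g] \<alpha>[unfolded T]]
    by (simp add: a_def[abs_def] comp_def)
  have \<alpha>R: "\<alpha> v \<in> ?R" if "v \<in> ?T" for v using \<alpha> that by (auto simp: bij_betw_def)
  have \<gamma>E: "\<gamma> i \<in> E" if E: "complex_subfield E" and "?R \<subseteq> E" for E i
    unfolding \<gamma>_def using that \<alpha>R
    by (intro subfield_prod[OF E] subfield_diff[OF E] subfield_of_nat[OF E]) (auto simp: D_def)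
  have perm: "bij_betw \<sigma> \<Gamma> \<Gamma> \<and> (\<forall>u\<in>index_tuples k \<Gamma>. \<sigma> (a u) = a (map \<sigma> u))"
    if E: "complex_subfield E" and \<sigma>: "field_embedding E \<sigma>" and RE: "?R \<subseteq> E" for E \<sigma>
  proof -
    obtain s where s: "s permutes {1..m}" and s\<alpha>: "\<And>v. v \<in> ?T \<Longrightarrow> \<sigma> (\<alpha> v) = \<alpha> (map s v)"
      using equiv[OF E \<sigma> RE] by blast
    have bs: "bij_betw s {1..m} {1..m}" using s by (rule permutes_imp_bij)
    have mT: "bij_betw (map s) ?T ?T" unfolding T by (rule bij_betw_map_index_tuples[OF bs])
    have hd_map: "hd (map s v) = s (hd v)" if "v \<in> ?T" for v
      using that k by (cases v) (auto simp: distinct_tuples_def)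
    have sD: "bij_betw (map s) (D i) (D (s i))" for i
    proof (rule bij_betw_subset[OF mT])
      show "D i \<subseteq> ?T" by (auto simp: D_def)
      show "map s ` D i = D (s i)"
      proof
        show "map s ` D i \<subseteq> D (s i)" using mT hd_map by (auto simp: D_def bij_betw_def)
        show "D (s i) \<subseteq> map s ` D i"
        proof
          fix w assume w: "w \<in> D (s i)"
          then obtain v where v: "v \<in> ?T" "w = map s v" using mT by (auto simp: D_def bij_betw_def)
          then have "s (hd v) = s i" using w hd_map by (simp add: D_def)
          then have "hd v = i" using permutes_inj[OF s] by (simp add: inj_eq)
          then show "w \<in> map s ` D i" using v by (auto simp: D_def)
        qed
      qed
    qed
    have \<sigma>\<gamma>: "\<sigma> (\<gamma> i) = \<gamma> (s i)" for i
    proof -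
      have inE: "\<alpha> v \<in> E" if "v \<in> D i" for v using \<alpha>R RE that by (auto simp: D_def)
      have "\<sigma> (\<gamma> i) = (\<Prod>v\<in>D i. \<sigma> (of_nat t - \<alpha> v))"
        unfolding \<gamma>_def
        by (rule embedding_prod[OF E \<sigma>]) (intro subfield_diff[OF E] subfield_of_nat[OF E] inE)
      also have "\<dots> = (\<Prod>v\<in>D i. of_nat t - \<alpha> (map s v))"
      proof (rule prod.cong[OF refl])
        fix v assume v: "v \<in> D i"
        have "\<sigma> (of_nat t - \<alpha> v) = \<sigma> (of_nat t) - \<sigma> (\<alpha> v)"
          by (rule embedding_diff[OF E \<sigma> subfield_of_nat[OF E] inE[OF v]])
        then show "\<sigma> (of_nat t - \<alpha> v) = of_nat t - \<alpha> (map s v)"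
          using s\<alpha>[of v] v by (simp add: embedding_of_nat[OF E \<sigma>] D_def)
      qed
      also have "\<dots> = \<gamma> (s i)" unfolding \<gamma>_def by (rule prod.reindex_bij_betw[OF sD])
      finally show ?thesis .
    qed
    \<comment> \<open>On \<open>\<Gamma>\<close> the embedding acts as \<open>s\<close> does on indices, which allows \<open>s\<close> to be eliminated.\<close>
    have g\<sigma>: "g (\<sigma> x) = s (g x)" if x: "x \<in> \<Gamma>" for x
    proof -
      have gx: "g x \<in> {1..m}" using g x by (auto simp: bij_betw_def)
      have "\<sigma> x = \<gamma> (s (g x))" using \<sigma>\<gamma>[of "g x"] \<gamma>g[OF x] by simp
      moreover have "s (g x) \<in> {1..m}" by (rule bij_betw_apply[OF bs gx])
      ultimately show ?thesis using g\<gamma> by simp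
    qed
    have "\<sigma> ` \<Gamma> = \<gamma> ` s ` {1..m}" by (simp add: \<Gamma>_def image_image \<sigma>\<gamma>)
    then have "\<sigma> ` \<Gamma> = \<Gamma>" using bs by (simp add: \<Gamma>_def bij_betw_def)
    then have "bij_betw \<sigma> \<Gamma> \<Gamma>"
      using fin\<Gamma> by (simp add: bij_betw_def eq_card_imp_inj_on)
    moreover have "\<sigma> (a u) = a (map \<sigma> u)" if u: "u \<in> index_tuples k \<Gamma>" for u
    proof -
      have "map g u \<in> ?T"
        using bij_betw_map_index_tuples[OF g, of k] u unfolding T by (auto simp: bij_betw_def)
      then have "\<sigma> (a u) = \<alpha> (map s (map g u))" by (simp add: a_def s\<alpha>)
      also have "map s (map g u) = map g (map \<sigma> u)"
        using u g\<sigma> by (auto simp: index_tuples_def)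
      finally show ?thesis by (simp add: a_def)
    qed
    ultimately show ?thesis by blast
  qed
  have alg: "algebraic_int (\<alpha> v)" if "v \<in> ?T" for v
    using algebraic_int_complex_roots[OF lead] \<alpha>R that by blast
  have val: "\<exists>z::int. (\<Prod>x\<in>\<Gamma>. of_nat j - x) = of_int z \<and>
      \<bar>real_of_int z\<bar> \<le> (real m + 1) ^ m * (real (m * m * N) + 1) ^ N * (real N + 1) * H"
    if j: "j \<in> {1..m}" for j
  proof -
    let ?w = "\<Prod>x\<in>\<Gamma>. of_nat j - x"
    have "?w \<in> \<int>"
    proof (rule integer_if_fixed[OF finR])
      show "algebraic_int ?w"
        unfolding \<Gamma>_def \<gamma>_def using alg
        by (intro algebraic_int_prod algebraic_int_diff)
           (auto simp: D_def intro!: algebraic_int_prod algebraic_int_diff)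
      show "?w \<in> E" if E: "complex_subfield E" and "?R \<subseteq> E" for E
        using \<gamma>E[OF E \<open>?R \<subseteq> E\<close>]
        by (intro subfield_prod[OF E] subfield_diff[OF E] subfield_of_nat[OF E]) (auto simp: \<Gamma>_def)
      show "\<sigma> ?w = ?w" if E: "complex_subfield E" and \<sigma>: "field_embedding E \<sigma>" and RE: "?R \<subseteq> E" for E \<sigma>
      proof -
        have \<Gamma>E: "x \<in> E" if "x \<in> \<Gamma>" for x using that \<gamma>E[OF E RE] by (auto simp: \<Gamma>_def)
        have "\<sigma> ?w = (\<Prod>x\<in>\<Gamma>. \<sigma> (of_nat j - x))"
          by (rule embedding_prod[OF E \<sigma>]) (intro subfield_diff[OF E] subfield_of_nat[OF E] \<Gamma>E)
        also have "\<dots> = (\<Prod>x\<in>\<Gamma>. of_nat j - \<sigma> x)"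
          using embedding_diff[OF E \<sigma> subfield_of_nat[OF E] \<Gamma>E]
          by (intro prod.cong refl) (simp add: embedding_of_nat[OF E \<sigma>])
        also have "\<dots> = ?w"
          using perm[OF E \<sigma> RE] by (intro prod.reindex_bij_betw) blast
        finally show ?thesis .
      qed
    qed (use algebraic_int_complex_roots[OF lead] in blast)
    then obtain z :: int where z: "?w = of_int z" by (auto elim: Ints_cases)
    define h where "h v = max 1 (cmod (\<alpha> v))" for v
    define t' where "t' = real t + 1"
    have h1: "1 \<le> h v" for v by (simp add: h_def)
    have factor: "cmod (of_nat j - \<gamma> i) \<le> (real m + 1) * (\<Prod>v\<in>D i. t' * h v)" for i
    proof -
      have ge1: "1 \<le> t' * h v" for v
        using h1[of v] mult_mono[of 1 t' 1 "h v"] by (simp add: t'_def)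
      have "cmod (\<gamma> i) \<le> (\<Prod>v\<in>D i. t' * h v)"
        unfolding \<gamma>_def prod_norm[symmetric]
      proof (rule prod_mono, intro conjI)
        fix v
        have "cmod (of_nat t - \<alpha> v) \<le> real t + cmod (\<alpha> v)"
          using norm_triangle_ineq4[of "of_nat t" "\<alpha> v"] by simp
        also have "\<dots> \<le> real t * h v + h v"
          using mult_left_mono[OF h1[of v], of "real t"] by (intro add_mono) (simp_all add: h_def)
        finally show "cmod (of_nat t - \<alpha> v) \<le> t' * h v" by (simp add: t'_def algebra_simps)
      qed simp
      moreover have "1 \<le> (\<Prod>v\<in>D i. t' * h v)" using ge1 by (intro prod_ge_1)
      moreover have "cmod (of_nat j - \<gamma> i) \<le> real m + cmod (\<gamma> i)"
        using norm_triangle_ineq4[of "of_nat j" "\<gamma> i"] j by simp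
      moreover have "real m * 1 \<le> real m * (\<Prod>v\<in>D i. t' * h v)"
        using calculation(2) by (intro mult_left_mono) auto
      ultimately show ?thesis by (simp add: algebra_simps)
    qed
    have "\<bar>real_of_int z\<bar> = cmod ?w" by (simp add: z)
    also have "\<dots> = (\<Prod>i\<in>{1..m}. cmod (of_nat j - \<gamma> i))"
      using prod.reindex_bij_betw[OF \<gamma>, of "\<lambda>x. cmod (of_nat j - x)"] by (simp add: prod_norm)
    also have "\<dots> \<le> (\<Prod>i\<in>{1..m}. (real m + 1) * (\<Prod>v\<in>D i. t' * h v))"
      using factor by (intro prod_mono) auto
    also have "\<dots> = (real m + 1) ^ m * (\<Prod>i\<in>{1..m}. \<Prod>v\<in>D i. t' * h v)"
      by (simp add: prod.distrib)
    also have "(\<Prod>i\<in>{1..m}. \<Prod>v\<in>D i. t' * h v) = (\<Prod>v\<in>?T. t' * h v)"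
      unfolding UD[symmetric] using finD by (intro prod.UNION_disjoint[symmetric]) (auto simp: D_def)
    also have "\<dots> = t' ^ N * (\<Prod>v\<in>?T. h v)" by (simp add: prod.distrib N)
    also have "(\<Prod>v\<in>?T. h v) = (\<Prod>x\<in>?R. max 1 (cmod x))"
      using prod.reindex_bij_betw[OF \<alpha>, of "\<lambda>x. max 1 (cmod x)"] by (simp add: h_def)
    also have "(real m + 1) ^ m * (t' ^ N * (\<Prod>x\<in>?R. max 1 (cmod x)))
        \<le> (real m + 1) ^ m * ((real (m * m * N) + 1) ^ N * ((real N + 1) * H))"
      using prod_roots_le[OF monic sep H] t
      by (intro mult_left_mono mult_mono power_mono) (auto simp: t'_def prod_nonneg simp flip: of_nat_mult)
    finally show ?thesis using z by (auto simp: mult.assoc)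
  qed
  have "compatible_labelling k f \<Gamma> a"
    using fin\<Gamma> aT perm unfolding compatible_labelling_def by blast
  then show ?thesis using card\<Gamma> val by blast
qed

section \<open>Counting the polynomials\<close>

text \<open>The product of the differences \<open>a u - a' u\<close> is fixed by all embeddings, because they permute the
  tuples \<open>u\<close> in the same way for both labellings; so it is an integer. It is not zero, since a common
  root would make the two polynomials equal.\<close>

lemma norm_of_root_difference_ge_1:
  assumes trans: "k_transitive m k G"
    and f: "f \<in> polys_with_galois_group H (perm_subgroup m G) (distinct_tuples m k) (tuple_action m k)"
    and f': "f' \<in> polys_with_galois_group H (perm_subgroup m G) (distinct_tuples m k) (tuple_action m k)"
    and a: "compatible_labelling k f \<Gamma> a" and a': "compatible_labelling k f' \<Gamma> a'"
    and "f \<noteq> f'"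
  shows "1 \<le> (\<Prod>u\<in>index_tuples k \<Gamma>. cmod (a u - a' u))"
proof -
  let ?A = "index_tuples k \<Gamma>"
  let ?w = "\<Prod>u\<in>?A. a u - a' u"
  have sep: "separable_poly f" "separable_poly f'" and lead: "lead_coeff f = 1" "lead_coeff f' = 1"
    and deg: "Polynomial.degree f = Polynomial.degree f'"
    using f f' by (auto simp: polys_with_galois_group_def monic_polys_def)
  have bij: "bij_betw a ?A (complex_roots f)" "bij_betw a' ?A (complex_roots f')"
    using a a' by (auto simp: compatible_labelling_def)
  have roots: "a u \<in> complex_roots f" "a' u \<in> complex_roots f'" if "u \<in> ?A" for u
    using bij that by (auto simp: bij_betw_def)
  have finA: "finite ?A" using a by (simp add: compatible_labelling_def finite_index_tuples)
  have alg: "algebraic_int x" if "x \<in> complex_roots f \<union> complex_roots f'" for x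
    using that algebraic_int_complex_roots lead by blast
  have "?w \<in> \<int>"
  proof (rule integer_if_fixed[OF _ alg])
    show "finite (complex_roots f \<union> complex_roots f')"
      using sep by (simp add: finite_complex_roots)
    show "algebraic_int ?w" using alg roots by (intro algebraic_int_prod algebraic_int_diff) auto
    show "?w \<in> E" if E: "complex_subfield E" and "complex_roots f \<union> complex_roots f' \<subseteq> E" for E
      using that roots by (intro subfield_prod[OF E] subfield_diff[OF E]) auto
    show "\<sigma> ?w = ?w"
      if E: "complex_subfield E" and \<sigma>: "field_embedding E \<sigma>"
        and RE: "complex_roots f \<union> complex_roots f' \<subseteq> E" for E \<sigma>
    proof -
      have inE: "a u \<in> E" "a' u \<in> E" if "u \<in> ?A" for u using roots[OF that] RE by auto
      have \<sigma>\<Gamma>: "bij_betw \<sigma> \<Gamma> \<Gamma>" and \<sigma>a: "\<forall>u\<in>?A. \<sigma> (a u) = a (map \<sigma> u)" "\<forall>u\<in>?A. \<sigma> (a' u) = a' (map \<sigma> u)"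
        using a a' E \<sigma> RE unfolding compatible_labelling_def by auto
      have "\<sigma> ?w = (\<Prod>u\<in>?A. \<sigma> (a u - a' u))"
        by (rule embedding_prod[OF E \<sigma>]) (intro subfield_diff[OF E] inE)
      also have "\<dots> = (\<Prod>u\<in>?A. a (map \<sigma> u) - a' (map \<sigma> u))"
        using embedding_diff[OF E \<sigma> inE] \<sigma>a by (intro prod.cong refl) simp
      also have "\<dots> = ?w"
        by (rule prod.reindex_bij_betw[OF bij_betw_map_index_tuples[OF \<sigma>\<Gamma>]])
      finally show ?thesis .
    qed
  qed
  then obtain z :: int where z: "?w = of_int z" by (auto elim: Ints_cases)
  have "z \<noteq> 0"
  proof
    assume "z = 0"
    then obtain u where u: "u \<in> ?A" "a u = a' u" using z finA by auto
    have "complex_roots f \<subseteq> complex_roots f'"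
      by (rule complex_roots_subset_of_common_root[OF trans f, of "a u"]) (use roots[OF u(1)] u(2) in simp_all)
    moreover have "complex_roots f' \<subseteq> complex_roots f"
      by (rule complex_roots_subset_of_common_root[OF trans f', of "a u"]) (use roots[OF u(1)] u(2) in simp_all)
    ultimately have "complex_roots f = complex_roots f'" by simp
    then have "complex_poly f = complex_poly f'"
      using complex_poly_eq_prod_roots[OF sep(1) lead(1)] complex_poly_eq_prod_roots[OF sep(2) lead(2)]
      by (simp only:)
    then have "Polynomial.coeff (complex_poly f) i = Polynomial.coeff (complex_poly f') i" for i
      by (rule arg_cong)
    then have "f = f'" by (intro poly_eqI) (simp add: coeff_map_poly)
    then show False using \<open>f \<noteq> f'\<close> by simp
  qed
  then have "1 \<le> cmod ?w" unfolding z by simp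
  then show ?thesis by (simp add: prod_norm)
qed


text \<open>Complex conjugation is itself an embedding, so it moves the entries of all vectors \<open>a f\<close> by the
  same permutation of the tuples. This is the symmetry that the count of separated vectors needs.\<close>

lemma card_polys_with_common_labelling_le:
  fixes H s Z :: real
  assumes k: "1 \<le> k" "k \<le> m" and trans: "k_transitive m k G"
    and H: "1 \<le> H" and s: "0 < s"
    and Z: "\<And>M::nat. (\<Sum>n\<in>{- int M..int M}. max 1 \<bar>real_of_int n\<bar> powr - s) \<le> Z"
    and N: "N = card (distinct_tuples m k)"
    and F: "\<And>f. f \<in> F \<Longrightarrow>
      f \<in> polys_with_galois_group H (perm_subgroup m G) (distinct_tuples m k) (tuple_action m k) \<and>
      compatible_labelling k f \<Gamma> (a f)"
    and \<Gamma>: "card \<Gamma> = m"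
  shows "real (card F) \<le> Z ^ N * (3 ^ N * ((real N + 1) * H)) powr s"
proof (cases "F = {}")
  case True
  have "0 \<le> Z" using Z[of 0] by simp
  then show ?thesis using True by simp
next
  case False
  let ?A = "index_tuples k \<Gamma>"
  have bij: "bij_betw (a f) ?A (complex_roots f)" if "f \<in> F" for f
    using F[OF that] by (simp add: compatible_labelling_def)
  obtain f0 where f0: "f0 \<in> F" using False by blast
  then have fin\<Gamma>: "finite \<Gamma>" using F by (auto simp: compatible_labelling_def)
  then have finA: "finite ?A" by (rule finite_index_tuples)
  obtain h where "bij_betw h {1..m} \<Gamma>"
    using fin\<Gamma> \<Gamma> finite_same_card_bij[of "{1..m}" \<Gamma>] by auto
  then have cardA: "card ?A = N"
    using bij_betw_same_card[OF bij_betw_map_index_tuples, of h "{1..m}" \<Gamma> k]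
    by (simp add: N distinct_tuples_eq_index_tuples)
  have "m \<noteq> 0" using k by simp
  then obtain x where "x \<in> \<Gamma>" using \<Gamma> by fastforce
  then have "?A \<noteq> {}" using index_tuples_hd_exists[OF fin\<Gamma> _ k(1)] k(2) \<Gamma> by blast
  have "real (card F) \<le> Z ^ card ?A * (3 ^ card ?A * ((real N + 1) * H)) powr s"
  proof (rule card_separated_conjugate_vectors_le[OF finA \<open>?A \<noteq> {}\<close> s _ Z])
    show "1 \<le> (real N + 1) * H" using H mult_mono[of 1 "real N + 1" 1 H] by simp
    have cnj: "bij_betw cnj \<Gamma> \<Gamma> \<and> (\<forall>u\<in>?A. cnj (a f u) = a f (map cnj u))" if "f \<in> F" for f
      using F[OF that] complex_subfield_UNIV field_embedding_cnj
      unfolding compatible_labelling_def by blast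
    show "map cnj u \<in> ?A" if "u \<in> ?A" for u
      using bij_betw_map_index_tuples[of cnj \<Gamma> \<Gamma> k] cnj[OF f0] that by (auto simp: bij_betw_def)
    show "a f (map cnj u) = cnj (a f u)" if "f \<in> F" "u \<in> ?A" for f u
      using cnj[OF that(1)] that(2) by simp
    show "(\<Prod>u\<in>?A. max 1 (cmod (a f u))) \<le> (real N + 1) * H" if f: "f \<in> F" for f
    proof -
      have "(\<Prod>u\<in>?A. max 1 (cmod (a f u))) = (\<Prod>x\<in>complex_roots f. max 1 (cmod x))"
        by (rule prod.reindex_bij_betw[OF bij[OF f]])
      also have "\<dots> \<le> (real N + 1) * H"
        using F[OF f] H by (intro prod_roots_le) (auto simp: polys_with_galois_group_def N)
      finally show ?thesis .
    qed
    show "1 \<le> (\<Prod>u\<in>?A. cmod (a f u - a g u))" if "f \<in> F" "g \<in> F" "f \<noteq> g" for f g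
      using norm_of_root_difference_ge_1[OF trans] F that by blast
  qed
  then show ?thesis by (simp add: cardA)
qed

theorem theorem1p3:
  fixes \<epsilon> :: real and m k :: nat and G :: "(nat \<Rightarrow> nat) set"
  assumes "\<epsilon> > 0" and "m \<ge> 2" and "1 \<le> k" and "k \<le> m"
    and "subgroup G (sym_group m)"
    and "k_transitive m k G"
  shows "\<exists>C > 0. \<forall>H :: real. H \<ge> 1 \<longrightarrow>
           real (card (polys_with_galois_group H (perm_subgroup m G)
                         (distinct_tuples m k) (tuple_action m k)))
             \<le> C * H powr (real m + 1 + \<epsilon>)"
proof -
  let ?T = "distinct_tuples m k"
  define N where "N = card ?T"
  define K where "K = (real m + 1) ^ m * (real (m * m * N) + 1) ^ N * (real N + 1)"
  obtain Z where Z: "0 < Z"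
    "\<And>M::nat. (\<Sum>n\<in>{- int M..int M}. max 1 \<bar>real_of_int n\<bar> powr - (1 + \<epsilon>)) \<le> Z"
    using sum_powr_int_bounded[of "1 + \<epsilon>"] assms(1) by (metis less_add_same_cancel1)
  define L where "L = 3 ^ N * (real N + 1)"
  define C where "C = (2 * K + 1) ^ m * (Z ^ N * L powr (1 + \<epsilon>))"
  have "0 < K" unfolding K_def by (intro mult_pos_pos zero_less_power add_nonneg_pos) simp_all
  have "0 < L" by (simp add: L_def)
  have "0 < C" using \<open>0 < K\<close> \<open>0 < L\<close> Z(1) by (simp add: C_def)
  moreover have "real (card (polys_with_galois_group H (perm_subgroup m G) ?T (tuple_action m k)))
      \<le> C * H powr (real m + 1 + \<epsilon>)" if H: "1 \<le> H" for H
  proof -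
    let ?B = "polys_with_galois_group H (perm_subgroup m G) ?T (tuple_action m k)"
    have finB: "finite ?B"
      by (rule finite_subset[OF _ finite_monic_polys[of "card ?T" H]])
         (auto simp: polys_with_galois_group_def)
    have "\<forall>f\<in>?B. \<exists>\<Gamma> a. compatible_labelling k f \<Gamma> a \<and> card \<Gamma> = m \<and>
      (\<forall>j\<in>{1..m}. \<exists>z::int. (\<Prod>x\<in>\<Gamma>. of_nat j - x) = of_int z \<and> \<bar>real_of_int z\<bar> \<le> K * H)"
      using compatible_labelling_exists[OF assms(3,4,5) H _ N_def] by (simp add: K_def)
    then obtain \<Gamma> a where \<Gamma>a: "\<And>f. f \<in> ?B \<Longrightarrow> compatible_labelling k f (\<Gamma> f) (a f) \<and> card (\<Gamma> f) = m \<and>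
      (\<forall>j\<in>{1..m}. \<exists>z::int. (\<Prod>x\<in>\<Gamma> f. of_nat j - x) = of_int z \<and> \<bar>real_of_int z\<bar> \<le> K * H)"
      by metis
    \<comment> \<open>There are \<open>O(H\<^sup>m)\<close> possible sets \<open>\<Gamma> f\<close>, and each is shared by \<open>O(H\<^sup>1\<^sup>+\<^sup>\<epsilon>)\<close> polynomials.\<close>
    have fin\<Gamma>: "finite S \<and> card S = m" if "S \<in> \<Gamma> ` ?B" for S
      using that \<Gamma>a by (auto simp: compatible_labelling_def)
    have "real (card (\<Gamma> ` ?B)) \<le> (2 * (K * H) + 1) ^ m"
    proof (rule card_sets_integral_values_le[OF _ fin\<Gamma>])
      show "0 \<le> K * H" using \<open>0 < K\<close> H by simp
      show "\<exists>z::int. (\<Prod>x\<in>S. of_nat j - x) = of_int z \<and> \<bar>real_of_int z\<bar> \<le> K * H"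
        if "S \<in> \<Gamma> ` ?B" "j \<in> {1..m}" for S j
        using that \<Gamma>a by auto
    qed
    also have "\<dots> \<le> ((2 * K + 1) * H) ^ m"
      using H \<open>0 < K\<close> by (intro power_mono) (auto simp: algebra_simps)
    finally have labels: "real (card (\<Gamma> ` ?B)) \<le> ((2 * K + 1) * H) ^ m" .
    have fibre: "real (card {f \<in> ?B. \<Gamma> f = S}) \<le> Z ^ N * (L * H) powr (1 + \<epsilon>)" if "S \<in> \<Gamma> ` ?B" for S
    proof -
      have "real (card {f \<in> ?B. \<Gamma> f = S}) \<le> Z ^ N * (3 ^ N * ((real N + 1) * H)) powr (1 + \<epsilon>)"
        using assms(1) \<Gamma>a fin\<Gamma>[OF that]
        by (intro card_polys_with_common_labelling_le[OF assms(3,4,6) H _ Z(2) N_def, where a = a and \<Gamma> = S]) auto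
      then show ?thesis by (simp add: L_def mult.assoc)
    qed
    have "?B = (\<Union>S\<in>\<Gamma> ` ?B. {f \<in> ?B. \<Gamma> f = S})" by auto
    then have "card ?B \<le> (\<Sum>S\<in>\<Gamma> ` ?B. card {f \<in> ?B. \<Gamma> f = S})"
      using card_UN_le[of "\<Gamma> ` ?B" "\<lambda>S. {f \<in> ?B. \<Gamma> f = S}"] finB by simp
    then have "real (card ?B) \<le> real (\<Sum>S\<in>\<Gamma> ` ?B. card {f \<in> ?B. \<Gamma> f = S})"
      by (rule of_nat_mono)
    also have "\<dots> = (\<Sum>S\<in>\<Gamma> ` ?B. real (card {f \<in> ?B. \<Gamma> f = S}))"
      by (simp only: of_nat_sum)
    also have "\<dots> \<le> (\<Sum>S\<in>\<Gamma> ` ?B. Z ^ N * (L * H) powr (1 + \<epsilon>))"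
      by (rule sum_mono) (rule fibre)
    also have "\<dots> = real (card (\<Gamma> ` ?B)) * (Z ^ N * (L * H) powr (1 + \<epsilon>))" by simp
    also have "\<dots> \<le> ((2 * K + 1) * H) ^ m * (Z ^ N * (L * H) powr (1 + \<epsilon>))"
      using labels Z(1) by (intro mult_right_mono) auto
    also have "\<dots> = C * (H ^ m * H powr (1 + \<epsilon>))"
      using H \<open>0 < L\<close> by (simp add: C_def power_mult_distrib powr_mult)
    also have "H ^ m * H powr (1 + \<epsilon>) = H powr (real m + 1 + \<epsilon>)"
      using H by (simp add: powr_add flip: powr_realpow)
    finally show ?thesis .
  qed
  ultimately show ?thesis by blast
qed

end
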